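(* Let $t,c,\Delta$ be positive integers. For every graph $H_1$ with treewidth at most $t$ and every graph $H_2$ with treewidth at most $t$ and maximum degree at most $\Delta$, the graph $G:=H_1\boxtimes H_2$ has a $c$-colouring with clustering at most $6^{c+1}(t+1)^2\Delta^c\,|V(G)|^{c/(c^2-c+1)}$.
   Context: All graphs are finite and simple. A colouring of a graph assigns a colour to each vertex (adjacent vertices may receive the same colour); a $c$-colouring uses at most $c$ colours. A monochromatic component is a connected component of the subgraph induced by the vertices of one colour. A colouring has clustering at most $k$ if every monochromatic component has at most $k$ vertices. The strong product $G\boxtimes H$ has vertex set $V(G)\times V(H)$, with distinct $(u,v),(u',v')$ adjacent iff ($u=u'$ and $vv'\in E(H)$) or ($v=v'$ and $uu'\in E(G)$) or ($uu'\in E(G)$ and $vv'\in E(H)$). *)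

theory Defs
  imports Complex_Main "Graph_Theory.Digraph_Component"
begin

text \<open>
  Finite simple graphs are elements of \<^typ>\<open>'a pair_pre_digraph\<close> satisfying
  \<^locale>\<open>pair_graph\<close>: finite vertex set, and a symmetric irreflexive edge relation
  containing both orientations of every edge. On such graphs \<^const>\<open>out_degree\<close> is
  the number of neighbours, and \<^const>\<open>pre_digraph.sccs\<close> is the set of connected
  components.
\<close>

definition max_degree :: "'a pair_pre_digraph \<Rightarrow> nat" where
  "max_degree G = Max (insert 0 (out_degree (with_proj G) ` pverts G))"

text \<open>
  The library's \<^const>\<open>tree\<close> is not usable here: it forbids directed cycles only, so a
  single edge in both orientations is not a tree, while an acyclically oriented triangle
  is. In a \<^locale>\<open>pair_graph\<close>, the directed cycles of length at least 3 are exactly the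
  cycles of the undirected graph.
\<close>

definition undirected_tree :: "'a pair_pre_digraph \<Rightarrow> bool" where
  "undirected_tree T \<longleftrightarrow>
     pair_graph T \<and>
     Digraph_Component.connected (with_proj T) \<and>
     \<not> (\<exists>p. pre_digraph.cycle (with_proj T) p \<and> length p \<ge> 3)"

text \<open>\<^const>\<open>Digraph_Component.connected\<close> includes non-emptiness.\<close>

definition tree_decomposition ::
    "'a pair_pre_digraph \<Rightarrow> 'n pair_pre_digraph \<Rightarrow> ('n \<Rightarrow> 'a set) \<Rightarrow> bool" where
  "tree_decomposition G T B \<longleftrightarrow>
     undirected_tree T \<and>
     (\<forall>x \<in> pverts T. B x \<subseteq> pverts G) \<and>
     (\<forall>(u, v) \<in> parcs G. \<exists>x \<in> pverts T. u \<in> B x \<and> v \<in> B x) \<and>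
     (\<forall>v \<in> pverts G.
        Digraph_Component.connected (with_proj T \<restriction> {x \<in> pverts T. v \<in> B x}))"

definition decomposition_width :: "'n pair_pre_digraph \<Rightarrow> ('n \<Rightarrow> 'a set) \<Rightarrow> nat" where
  "decomposition_width T B = Max ((\<lambda>x. card (B x)) ` pverts T) - 1"

text \<open>
  The nodes of the trees are natural numbers, which is no restriction as the trees are
  finite. Because of truncated subtraction the null graph has treewidth 0 instead of -1.
\<close>

definition treewidth :: "'a pair_pre_digraph \<Rightarrow> nat" where
  "treewidth G =
     (LEAST k. \<exists>(T :: nat pair_pre_digraph) B.
        tree_decomposition G T B \<and> decomposition_width T B = k)"

definition strong_product ::
    "'a pair_pre_digraph \<Rightarrow> 'b pair_pre_digraph \<Rightarrow> ('a \<times> 'b) pair_pre_digraph"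
    (infixl \<open>\<boxtimes>\<close> 70) where
  "G \<boxtimes> H =
     \<lparr> pverts = pverts G \<times> pverts H,
       parcs = {((u, v), (u', v')) | u v u' v'.
         (u, v) \<in> pverts G \<times> pverts H \<and>
         (u', v') \<in> pverts G \<times> pverts H \<and>
         (u, v) \<noteq> (u', v') \<and>
         (u = u' \<and> (v, v') \<in> parcs H \<or>
          v = v' \<and> (u, u') \<in> parcs G \<or>
          (u, u') \<in> parcs G \<and> (v, v') \<in> parcs H)} \<rparr>"

definition uses_at_most_colours ::
    "'a pair_pre_digraph \<Rightarrow> ('a \<Rightarrow> 'c) \<Rightarrow> nat \<Rightarrow> bool" where
  "uses_at_most_colours G f c \<longleftrightarrow> card (f ` pverts G) \<le> c"

definition monochromatic_components ::
    "'a pair_pre_digraph \<Rightarrow> ('a \<Rightarrow> 'c) \<Rightarrow> ('a, 'a \<times> 'a) pre_digraph set" where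
  "monochromatic_components G f =
     (\<Union>i \<in> f ` pverts G. pre_digraph.sccs (with_proj G \<restriction> {v \<in> pverts G. f v = i}))"

definition clustering_at_most ::
    "'a pair_pre_digraph \<Rightarrow> ('a \<Rightarrow> 'c) \<Rightarrow> real \<Rightarrow> bool" where
  "clustering_at_most G f k \<longleftrightarrow>
     (\<forall>C \<in> monochromatic_components G f. real (card (verts C)) \<le> k)"

end

theory Submission
  imports Defs
begin

text \<open>
  Let \<open>n = |V(H\<^sub>1 \<boxtimes> H\<^sub>2)|\<close> and \<open>D = c\<^sup>2 - c + 1\<close>. Removing few bags repeatedly, \<open>H\<^sub>1\<close> has for every \<open>r\<close>
  an \<open>r\<close>-colouring ("levels") with clustering \<open>(t + 1) |V(H\<^sub>1)|\<^bsup>1/r\<^esup>\<close>. If \<open>|V(H\<^sub>2)| \<le> n\<^bsup>1/D\<^esup>\<close>, the levels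
  for \<open>r = c\<close>, copied along \<open>H\<^sub>2\<close>, do the job.

  Otherwise take \<open>m = c - 1\<close> levels on \<open>H\<^sub>1\<close>, and layers on \<open>H\<^sub>2\<close> such that adjacent vertices are in equal or
  consecutive layers and connected sets within \<open>m\<close> consecutive layers are small. On each layer the \<open>m\<close> levels
  use \<open>m\<close> of the \<open>c\<close> colours; from one layer to the next, exactly one level trades its colour for the unused
  one, the levels taking turns. So a monochromatic component stays within one level and \<open>m\<close> layers.
\<close>

subsection \<open>Separators from trees\<close>

text \<open>Connectedness in cut form; the empty set is linked.\<close>

definition linked :: "('a \<times> 'a) set \<Rightarrow> 'a set \<Rightarrow> bool" where
  "linked E C \<longleftrightarrow> (\<forall>A \<subseteq> C. A \<noteq> {} \<longrightarrow> A \<noteq> C \<longrightarrow> (\<exists>a \<in> A. \<exists>b \<in> C - A. (a, b) \<in> E))"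

lemma linkedD:
  assumes "linked E C" "A \<subseteq> C" "A \<noteq> {}" "A \<noteq> C"
  obtains a b where "a \<in> A" "b \<in> C - A" "(a, b) \<in> E"
  using assms unfolding linked_def by blast

text \<open>Otherwise \<open>C \<inter> P\<close> is a cut of \<open>C\<close>, and the edge leaving
  it runs from \<open>P\<close> to \<open>Q\<close>.\<close>

lemma linked_subset_cases:
  assumes "linked E C" "C \<subseteq> P \<union> Q" "E \<inter> P \<times> Q = {}" "P \<inter> Q = {}"
  shows "C \<subseteq> P \<or> C \<subseteq> Q"
proof (rule ccontr)
  assume "\<not> ?thesis"
  then have "C \<inter> P \<noteq> {}" "C \<inter> P \<noteq> C" using assms(2) by auto
  then obtain a b where "a \<in> C \<inter> P" "b \<in> C - C \<inter> P" "(a, b) \<in> E"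
    using linkedD[OF assms(1), of "C \<inter> P"] by (metis Int_lower1)
  then show False using assms by blast
qed

text \<open>A cut of the image pulls back to a cut of \<open>C\<close>. Edges may collapse under
  \<open>h\<close>, as they do under the projections of a strong product.\<close>

lemma linked_image:
  assumes "linked E C" "\<And>a b. a \<in> C \<Longrightarrow> b \<in> C \<Longrightarrow> (a, b) \<in> E \<Longrightarrow> h a \<noteq> h b \<Longrightarrow> (h a, h b) \<in> F"
  shows "linked F (h ` C)"
  unfolding linked_def
proof (intro allI impI)
  fix A assume A: "A \<subseteq> h ` C" "A \<noteq> {}" "A \<noteq> h ` C"
  let ?A = "{z \<in> C. h z \<in> A}"
  have "?A \<noteq> {}" "?A \<noteq> C" using A by auto
  then obtain a b where "a \<in> ?A" "b \<in> C - ?A" "(a, b) \<in> E"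
    using linkedD[OF assms(1), of ?A] by (metis (no_types, lifting) mem_Collect_eq subsetI)
  then show "\<exists>a\<in>A. \<exists>b\<in>h ` C - A. (a, b) \<in> F"
    using assms(2)[of a b] by (intro bexI[of _ "h a"] bexI[of _ "h b"]) force+
qed

lemma linked_const:
  assumes "linked E C" "\<And>a b. a \<in> C \<Longrightarrow> b \<in> C \<Longrightarrow> (a, b) \<in> E \<Longrightarrow> g a = g b" "u \<in> C" "v \<in> C"
  shows "g u = g v"
proof (rule ccontr)
  assume "g u \<noteq> g v"
  then have "{z \<in> C. g z = g u} \<noteq> {}" "{z \<in> C. g z = g u} \<noteq> C" using assms(3,4) by force+
  then obtain a b where "a \<in> {z \<in> C. g z = g u}" "b \<in> C - {z \<in> C. g z = g u}" "(a, b) \<in> E"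
    using linkedD[OF assms(1), of "{z \<in> C. g z = g u}"] by (metis (no_types, lifting) mem_Collect_eq subsetI)
  then show False using assms(2)[of a b] by auto
qed

section \<open>Trees grown leaf by leaf\<close>

text \<open>This form of trees gives induction on leaves directly; a new node with a single
  neighbour in \<open>N\<close> cannot close a cycle.\<close>

inductive grown_tree :: "('n \<times> 'n) set \<Rightarrow> 'n set \<Rightarrow> bool" for F where
  root: "grown_tree F {r}"
| leaf: "grown_tree F N \<Longrightarrow> n \<notin> N \<Longrightarrow> p \<in> N \<Longrightarrow> (n, p) \<in> F \<Longrightarrow>
    (\<And>q. q \<in> N \<Longrightarrow> (n, q) \<in> F \<or> (q, n) \<in> F \<Longrightarrow> q = p) \<Longrightarrow> grown_tree F (insert n N)"

lemma grown_tree_finite: "grown_tree F N \<Longrightarrow> finite N"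
  by (induction rule: grown_tree.induct) (rule finite.insertI, (rule finite.emptyI | assumption))+

text \<open>Place \<open>n\<close> on the side of its only possible neighbour \<open>p\<close>: the
  edge of \<open>D\<close> across the cut then avoids \<open>n\<close>, so it also crosses the cut
  of \<open>D - {n}\<close>.\<close>

lemma linked_remove_leaf:
  assumes "linked F D" "D \<subseteq> insert n N" "n \<notin> N" "sym F"
    and only: "\<And>q. q \<in> N \<Longrightarrow> (n, q) \<in> F \<Longrightarrow> q = p"
  shows "linked F (D - {n})"
  unfolding linked_def
proof (intro allI impI)
  fix A assume A: "A \<subseteq> D - {n}" "A \<noteq> {}" "A \<noteq> D - {n}"
  show "\<exists>a\<in>A. \<exists>b\<in>D - {n} - A. (a, b) \<in> F"
  proof (cases "p \<in> A")
    case True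
    have "insert n A \<inter> D \<noteq> {}" "insert n A \<inter> D \<noteq> D" using A by auto
    then obtain a b where ab: "a \<in> insert n A \<inter> D" "b \<in> D - insert n A \<inter> D" "(a, b) \<in> F"
      using linkedD[OF assms(1), of "insert n A \<inter> D"] by (metis Int_lower2)
    then have "b \<in> N" using assms(2) A by auto
    then have "a \<noteq> n" using only ab True by auto
    then show ?thesis using ab A by blast
  next
    case False
    have "A \<noteq> D" "A \<subseteq> D" using A by auto
    then obtain a b where ab: "a \<in> A" "b \<in> D - A" "(a, b) \<in> F"
      using linkedD[OF assms(1)] A(2) by metis
    have "a \<in> N" using ab A assms(2) by auto
    then have "b \<noteq> n" using only[of a] symD[OF assms(4) ab(3)] False ab(1) by auto
    then show ?thesis using ab by blast
  qed
qed

text \<open>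
  Greedily from the leaves: a leaf heavier than \<open>x\<close> goes into \<open>J\<close>, any other leaf passes its weight to its
  neighbour.
\<close>

lemma grown_tree_separator:
  fixes W :: "'n \<Rightarrow> real"
  assumes "grown_tree F N" "sym F" "0 \<le> x" "\<And>i. i \<in> N \<Longrightarrow> 0 \<le> W i"
  shows "\<exists>J \<subseteq> N. (J = {} \<or> real (card J) * x < sum W N) \<and>
    (\<forall>D \<subseteq> N - J. linked F D \<longrightarrow> sum W D \<le> x)"
  using assms
proof (induction arbitrary: W rule: grown_tree.induct)
  case (root r)
  show ?case
  proof (cases "W r \<le> x")
    case True
    have "sum W D \<le> x" if "D \<subseteq> {r} - {}" for D
    proof -
      have "D = {} \<or> D = {r}" using that by auto
      then show ?thesis using True root by auto
    qed
    then show ?thesis by (intro exI[of _ "{}"]) auto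
  next
    case False
    then show ?thesis using root by (intro exI[of _ "{r}"]) auto
  qed
next
  case (leaf N n p W)
  note N = grown_tree_finite[OF leaf(1)]
  have nonneg: "0 \<le> W i" if "i \<in> N" for i using leaf(9) that by auto
  have lnk: "linked F (D - {n})" if "linked F D" "D \<subseteq> insert n N" for D
    by (rule linked_remove_leaf[OF that leaf(2,7), of p]) (use leaf(5) in auto)
  show ?case
  proof (cases "W n \<le> x")
    case False
    have "\<exists>J \<subseteq> N. (J = {} \<or> real (card J) * x < sum W N) \<and>
        (\<forall>D \<subseteq> N - J. linked F D \<longrightarrow> sum W D \<le> x)"
      by (rule leaf(6)[OF leaf(7,8)]) (rule nonneg)
    then obtain J where J: "J \<subseteq> N" "J = {} \<or> real (card J) * x < sum W N"
      "\<forall>D \<subseteq> N - J. linked F D \<longrightarrow> sum W D \<le> x"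
      by metis
    have fJ: "finite J" "n \<notin> J" using J(1) N leaf(2) finite_subset by auto
    have "real (card (insert n J)) * x = x + real (card J) * x"
      using fJ by (simp add: algebra_simps)
    also have "\<dots> < W n + sum W N"
      using J(2) False sum_nonneg[of N W] nonneg by force
    finally have "real (card (insert n J)) * x < sum W (insert n N)"
      using N leaf(2) by simp
    then show ?thesis using J by (intro exI[of _ "insert n J"]) auto
  next
    case True
    define W' where "W' = W(p := W p + W n)"
    have W'0: "0 \<le> W' i" if "i \<in> N" for i
      using nonneg[OF that] leaf(9)[of n] nonneg[OF leaf(3)] by (auto simp: W'_def)
    have sumW': "sum W' D = sum W D + (if p \<in> D then W n else 0)" if "finite D" for D
    proof -
      have "sum W' D = sum (\<lambda>i. W i + (if i = p then W n else 0)) D"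
        by (rule sum.cong) (auto simp: W'_def)
      also have "\<dots> = sum W D + (if p \<in> D then W n else 0)"
        using that by (simp add: sum.distrib)
      finally show ?thesis .
    qed
    have "\<exists>J \<subseteq> N. (J = {} \<or> real (card J) * x < sum W' N) \<and>
        (\<forall>D \<subseteq> N - J. linked F D \<longrightarrow> sum W' D \<le> x)"
      by (rule leaf(6)[OF leaf(7,8)]) (rule W'0)
    then obtain J where J: "J \<subseteq> N" "J = {} \<or> real (card J) * x < sum W' N"
      "\<forall>D \<subseteq> N - J. linked F D \<longrightarrow> sum W' D \<le> x"
      by metis
    have "sum W' N = sum W (insert n N)" using sumW'[OF N] leaf(2,3) N by simp
    moreover have "sum W D \<le> x" if D: "D \<subseteq> insert n N - J" "linked F D" for D
    proof -
      have fD: "finite D" using D N finite_subset by (metis finite_Diff finite_insert)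
      let ?D = "D - {n}"
      have "linked F ?D" using lnk D by blast
      moreover have "?D \<subseteq> N - J" using D by auto
      ultimately have le: "sum W' ?D \<le> x" using J(3) by blast
      show ?thesis
      proof (cases "n \<in> D")
        case False
        then show ?thesis using le sumW'[of D] fD leaf(9)[of n] by (simp split: if_splits)
      next
        case nD: True
        show ?thesis
        proof (cases "D = {n}")
          case True
          then show ?thesis using \<open>W n \<le> x\<close> by simp
        next
          case False
          \<comment> \<open>A linked set containing \<open>n\<close> and a further node contains
            \<open>p\<close>, so the weight passed on to \<open>p\<close> accounts for that of
            \<open>n\<close>.\<close>
          then obtain a b where "a \<in> {n}" "b \<in> D - {n}" "(a, b) \<in> F"
            using linkedD[OF D(2), of "{n}"] nD by blast
          then have "p \<in> D - {n}" using leaf(5)[of b] D by auto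
          then have "sum W' ?D = sum W ?D + W n" using sumW'[of ?D] fD by simp
          also have "\<dots> = sum W D" using sum.remove[OF fD nD, of W] by simp
          finally show ?thesis using le by simp
        qed
      qed
    qed
    ultimately show ?thesis using J by (intro exI[of _ J]) auto
  qed
qed

text \<open>In a graph of treewidth less than \<open>k\<close>, the set \<open>X\<close> is a union of \<open>j\<close> bags.\<close>

definition separable :: "('a \<times> 'a) set \<Rightarrow> 'a set \<Rightarrow> nat \<Rightarrow> bool" where
  "separable E V k \<longleftrightarrow> (\<forall>(w :: 'a \<Rightarrow> real) x. (\<forall>v \<in> V. 0 \<le> w v) \<longrightarrow> 0 \<le> x \<longrightarrow>
     (\<exists>X \<subseteq> V. \<exists>j. card X \<le> k * j \<and> (j = 0 \<or> real j * x < sum w V) \<and>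
        (\<forall>C \<subseteq> V - X. linked E C \<longrightarrow> sum w C \<le> x)))"

lemma separableE:
  fixes w :: "'a \<Rightarrow> real"
  assumes "separable E V k" "\<And>v. v \<in> V \<Longrightarrow> 0 \<le> w v" "0 \<le> x"
  obtains X j where "X \<subseteq> V" "card X \<le> k * j" "j = 0 \<or> real j * x < sum w V"
    "\<forall>C \<subseteq> V - X. linked E C \<longrightarrow> sum w C \<le> x"
proof -
  have "\<exists>X \<subseteq> V. \<exists>j. card X \<le> k * j \<and> (j = 0 \<or> real j * x < sum w V) \<and>
        (\<forall>C \<subseteq> V - X. linked E C \<longrightarrow> sum w C \<le> x)"
    by (rule assms(1)[unfolded separable_def, THEN spec, THEN spec, THEN mp, THEN mp])
      (use assms(2,3) in auto)
  then show ?thesis by (elim exE conjE) (rule that)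
qed

text \<open>Extend the weights by zero outside \<open>U\<close> and intersect the separator with
  \<open>U\<close>.\<close>

lemma separable_subset:
  assumes "separable E V k" "U \<subseteq> V" "finite V"
  shows "separable E U k"
  unfolding separable_def
proof (intro allI impI)
  fix w :: "'a \<Rightarrow> real" and x :: real assume w: "\<forall>v \<in> U. 0 \<le> w v" and x: "0 \<le> x"
  define w' where "w' v = (if v \<in> U then w v else 0)" for v
  have eq: "sum w' C = sum w C" if "C \<subseteq> U" for C
    by (rule sum.cong) (use that in \<open>auto simp: w'_def\<close>)
  have UV: "sum w' V = sum w' U"
    by (rule sum.mono_neutral_right) (use assms in \<open>auto simp: w'_def\<close>)
  have w'0: "0 \<le> w' v" if "v \<in> V" for v using w by (auto simp: w'_def)
  obtain X j where X: "X \<subseteq> V" "card X \<le> k * j" "j = 0 \<or> real j * x < sum w' V"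
    "\<forall>C \<subseteq> V - X. linked E C \<longrightarrow> sum w' C \<le> x"
    by (rule separableE[where w = w', OF assms(1) w'0 x])
  have "card (X \<inter> U) \<le> k * j"
    using X(1,2) assms(3) by (meson Int_lower1 card_mono finite_subset le_trans)
  moreover have "sum w C \<le> x" if C: "C \<subseteq> U - X \<inter> U" "linked E C" for C
  proof -
    have "C \<subseteq> V - X" "C \<subseteq> U" using C(1) assms(2) by auto
    then show ?thesis using X(4) C(2) eq[of C] by metis
  qed
  ultimately show "\<exists>X \<subseteq> U. \<exists>j. card X \<le> k * j \<and> (j = 0 \<or> real j * x < sum w U) \<and>
        (\<forall>C \<subseteq> U - X. linked E C \<longrightarrow> sum w C \<le> x)"
    using X(3) UV eq[of U] by (intro exI[of _ "X \<inter> U"] conjI exI[of _ j]) auto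
qed

text \<open>Each vertex gives its weight to one node whose bag contains it, and the tree is
  separated for these node weights. A linked set avoiding the removed bags meets only the bags of a
  linked set of remaining nodes, whose weight bounds its own.\<close>

lemma separable_of_bags:
  fixes B :: "'n \<Rightarrow> 'a set"
  assumes "grown_tree F N" "sym F" "finite V"
    and bag: "\<And>x. x \<in> N \<Longrightarrow> B x \<subseteq> V" "\<And>x. x \<in> N \<Longrightarrow> card (B x) \<le> k"
    and edge: "\<And>u v. (u, v) \<in> E \<Longrightarrow> \<exists>x \<in> N. u \<in> B x \<and> v \<in> B x"
    and nodes: "\<And>v. v \<in> V \<Longrightarrow> {x \<in> N. v \<in> B x} \<noteq> {}" "\<And>v. v \<in> V \<Longrightarrow> linked F {x \<in> N. v \<in> B x}"
  shows "separable E V k"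
  unfolding separable_def
proof (intro allI impI)
  fix w :: "'a \<Rightarrow> real" and x :: real assume w: "\<forall>v \<in> V. 0 \<le> w v" and x: "0 \<le> x"
  note N = grown_tree_finite[OF assms(1)]
  have "\<forall>v \<in> V. \<exists>i. i \<in> N \<and> v \<in> B i" using nodes(1) by blast
  then obtain home where home: "\<And>v. v \<in> V \<Longrightarrow> home v \<in> N \<and> v \<in> B (home v)"
    by (auto dest!: bchoice)
  define W where "W i = sum w {v \<in> V. home v = i}" for i
  have W0: "0 \<le> W i" for i unfolding W_def by (rule sum_nonneg) (use w in auto)
  have Wsum: "sum W D = sum w {v \<in> V. home v \<in> D}" if "finite D" for D
  proof -
    have "sum w {v \<in> V. home v \<in> D} = (\<Sum>i\<in>D. sum w {v \<in> {v \<in> V. home v \<in> D}. home v = i})"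
      by (rule sum.group[symmetric]) (use assms(3) that in auto)
    also have "\<dots> = sum W D"
      unfolding W_def by (intro sum.cong) auto
    finally show ?thesis by simp
  qed
  have "\<exists>J \<subseteq> N. (J = {} \<or> real (card J) * x < sum W N) \<and>
      (\<forall>D \<subseteq> N - J. linked F D \<longrightarrow> sum W D \<le> x)"
    by (rule grown_tree_separator[OF assms(1,2) x]) (rule W0)
  then obtain J where J: "J \<subseteq> N" "J = {} \<or> real (card J) * x < sum W N"
    "\<forall>D \<subseteq> N - J. linked F D \<longrightarrow> sum W D \<le> x"
    by metis
  have fJ: "finite J" using J(1) N finite_subset by auto
  define X where "X = (\<Union>i\<in>J. B i)"
  have "card X \<le> sum (\<lambda>i. card (B i)) J" unfolding X_def by (rule card_UN_le[OF fJ])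
  also have "\<dots> \<le> card J * k" using sum_bounded_above[of J "\<lambda>i. card (B i)" k] bag(2) J(1) by auto
  finally have cX: "card X \<le> k * card J" by (simp add: mult.commute)
  have "sum W N = sum w V"
    unfolding Wsum[OF N] by (rule sum.cong) (use home in auto)
  then have jx: "card J = 0 \<or> real (card J) * x < sum w V" using J(2) by auto
  have "sum w C \<le> x" if C: "C \<subseteq> V - X" "linked E C" for C
  proof -
    define D where "D = {i \<in> N. B i \<inter> C \<noteq> {}}"
    have DJ: "D \<subseteq> N - J" using C by (auto simp: D_def X_def)
    have "linked F D"
      unfolding linked_def
    proof (intro allI impI, rule ccontr)
      fix A assume A: "A \<subseteq> D" "A \<noteq> {}" "A \<noteq> D" and "\<not> (\<exists>a\<in>A. \<exists>b\<in>D - A. (a, b) \<in> F)"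
      then have no: "(a, b) \<notin> F" if "a \<in> A" "b \<in> D - A" for a b using that by blast
      have inD: "{i \<in> N. v \<in> B i} \<subseteq> D" if "v \<in> C" for v using that by (auto simp: D_def)
      have side: "{i \<in> N. v \<in> B i} \<subseteq> A \<or> {i \<in> N. v \<in> B i} \<subseteq> D - A" if "v \<in> C" for v
        by (rule linked_subset_cases[of F])
          (use nodes(2)[of v] that C inD[OF that] A no in blast)+
      \<comment> \<open>If no tree edge crosses from \<open>A\<close> to \<open>D - A\<close>, the
        nodes of each vertex of \<open>C\<close> lie on one side. \<open>CA\<close> collects the
        vertices on the side of \<open>A\<close>; an edge of \<open>C\<close> leaving
        \<open>CA\<close> has both ends in a common bag, whose node would be on both sides.\<close>
      define CA where "CA = {v \<in> C. {i \<in> N. v \<in> B i} \<subseteq> A}"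
      obtain a where "a \<in> A" using A by auto
      then obtain v where "v \<in> C" "v \<in> B a" "a \<in> N" using A by (auto simp: D_def)
      then have "v \<in> CA" using side[of v] \<open>a \<in> A\<close> by (auto simp: CA_def)
      obtain b where "b \<in> D" "b \<notin> A" using A by auto
      then obtain u where "u \<in> C" "u \<in> B b" "b \<in> N" by (auto simp: D_def)
      then have "u \<notin> CA" using \<open>b \<notin> A\<close> by (auto simp: CA_def)
      have "CA \<subseteq> C" "CA \<noteq> {}" "CA \<noteq> C"
        using \<open>v \<in> CA\<close> \<open>u \<in> C\<close> \<open>u \<notin> CA\<close> by (auto simp: CA_def)
      then obtain y z where yz: "y \<in> CA" "z \<in> C - CA" "(y, z) \<in> E"
        using linkedD[OF C(2)] by metis
      then obtain i where "i \<in> N" "y \<in> B i" "z \<in> B i" using edge by blast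
      then show False using yz side[of z] unfolding CA_def by blast
    qed
    then have "sum W D \<le> x" using J(3) DJ by blast
    moreover have fD: "finite D" using N by (simp add: D_def)
    moreover have "sum w C \<le> sum w {v \<in> V. home v \<in> D}"
    proof (rule sum_mono2)
      show "C \<subseteq> {v \<in> V. home v \<in> D}"
      proof
        fix v assume "v \<in> C"
        moreover from this have "v \<in> V" using C by auto
        ultimately show "v \<in> {v \<in> V. home v \<in> D}" using home[of v] by (auto simp: D_def)
      qed
    qed (use assms(3) w in auto)
    ultimately show ?thesis using Wsum[OF fD] by simp
  qed
  moreover have "X \<subseteq> V" using bag(1) J(1) by (auto simp: X_def)
  ultimately show "\<exists>X \<subseteq> V. \<exists>j. card X \<le> k * j \<and> (j = 0 \<or> real j * x < sum w V) \<and>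
        (\<forall>C \<subseteq> V - X. linked E C \<longrightarrow> sum w C \<le> x)"
    using cX jx by (intro exI[of _ X] conjI exI[of _ "card J"]) auto
qed

subsection \<open>Levels and balanced separations\<close>

text \<open>Linked sets never straddle a cut without edges, so the two sides can be levelled
  independently. Splitting along such cuts until the parts are linked replaces an explicit use of
  components.\<close>

lemma levels_of_linked_parts:
  assumes "finite U" "sym E"
    and "\<And>A. A \<subseteq> U \<Longrightarrow> linked E A \<Longrightarrow> \<exists>g. (\<forall>v \<in> A. g v < r) \<and>
      (\<forall>C \<subseteq> A. \<forall>i. linked E C \<longrightarrow> (\<forall>v \<in> C. g v = i) \<longrightarrow> real (card C) \<le> b)"
  shows "\<exists>g. (\<forall>v \<in> U. g v < (r :: nat)) \<and>
      (\<forall>C \<subseteq> U. \<forall>i. linked E C \<longrightarrow> (\<forall>v \<in> C. g v = i) \<longrightarrow> real (card C) \<le> b)"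
  using assms(1,3)
proof (induction U rule: finite_psubset_induct)
  case (psubset U)
  show ?case
  proof (cases "linked E U")
    case True
    show ?thesis by (rule psubset.prems[OF order_refl True])
  next
    case False
    then obtain A where A: "A \<subseteq> U" "A \<noteq> {}" "A \<noteq> U" and no: "E \<inter> A \<times> (U - A) = {}"
      unfolding linked_def by blast
    have "A \<subset> U" "U - A \<subset> U" using A by auto
    have "\<exists>g. (\<forall>v \<in> A. g v < r) \<and>
        (\<forall>C \<subseteq> A. \<forall>i. linked E C \<longrightarrow> (\<forall>v \<in> C. g v = i) \<longrightarrow> real (card C) \<le> b)"
      by (rule psubset.IH[OF \<open>A \<subset> U\<close>], rule psubset.prems) (use A in auto)
    then obtain g where g: "\<forall>v \<in> A. g v < r"
      "\<forall>C \<subseteq> A. \<forall>i. linked E C \<longrightarrow> (\<forall>v \<in> C. g v = i) \<longrightarrow> real (card C) \<le> b"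
      by (elim exE conjE)
    have "\<exists>g. (\<forall>v \<in> U - A. g v < r) \<and>
        (\<forall>C \<subseteq> U - A. \<forall>i. linked E C \<longrightarrow> (\<forall>v \<in> C. g v = i) \<longrightarrow> real (card C) \<le> b)"
      by (rule psubset.IH[OF \<open>U - A \<subset> U\<close>], rule psubset.prems) auto
    then obtain h where h: "\<forall>v \<in> U - A. h v < r"
      "\<forall>C \<subseteq> U - A. \<forall>i. linked E C \<longrightarrow> (\<forall>v \<in> C. h v = i) \<longrightarrow> real (card C) \<le> b"
      by (elim exE conjE)
    define f where "f v = (if v \<in> A then g v else h v)" for v
    have "real (card C) \<le> b" if C: "C \<subseteq> U" "linked E C" "\<forall>v \<in> C. f v = i" for C i
    proof -
      have "C \<subseteq> A \<or> C \<subseteq> U - A"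
        by (rule linked_subset_cases[OF C(2) _ no]) (use C in auto)
      then show ?thesis
      proof
        assume "C \<subseteq> A"
        then have "\<forall>v \<in> C. g v = i" using C(3) unfolding f_def by (metis subsetD)
        then show ?thesis using g(2) C(2) \<open>C \<subseteq> A\<close> by simp
      next
        assume "C \<subseteq> U - A"
        then have "\<forall>v \<in> C. h v = i" using C(3) unfolding f_def by (metis DiffD2 subsetD)
        then show ?thesis using h(2) C(2) \<open>C \<subseteq> U - A\<close> by simp
      qed
    qed
    moreover have "\<forall>v \<in> U. f v < r" using g(1) h(1) by (simp add: f_def)
    ultimately show ?thesis by blast
  qed
qed

text \<open>With threshold \<open>p ^ r\<close>, at most \<open>p\<close> bags are removed from a
  set of at most \<open>p ^ Suc r\<close> vertices. They form one level of at most
  \<open>k * p\<close> vertices in total, and each linked part of the rest has at most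
  \<open>p ^ r\<close> vertices, enough for \<open>r\<close> further levels by induction.\<close>

lemma levels_exist:
  fixes p :: real
  assumes "finite V" "sym E" "separable E V k" "0 < p" "1 \<le> k" "1 \<le> r"
    and "U \<subseteq> V" "real (card U) \<le> p ^ r"
  shows "\<exists>g. (\<forall>v \<in> U. g v < (r :: nat)) \<and>
      (\<forall>C \<subseteq> U. \<forall>i. linked E C \<longrightarrow> (\<forall>v \<in> C. g v = i) \<longrightarrow> real (card C) \<le> real k * p)"
  using assms(6-8)
proof (induction r arbitrary: U rule: nat_induct_at_least)
  case base
  have "real (card C) \<le> real k * p" if "C \<subseteq> U" for C
  proof -
    have "finite U" using base(1) assms(1) finite_subset by auto
    then have "real (card C) \<le> real (card U)" using that by (simp add: card_mono)
    also have "\<dots> \<le> 1 * p" using base(2) by simp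
    also have "\<dots> \<le> real k * p" using assms(4,5) by (intro mult_right_mono) auto
    finally show ?thesis .
  qed
  then show ?case by (intro exI[of _ "\<lambda>_. 0"]) auto
next
  case (Suc r)
  have fU: "finite U" using Suc.prems(1) assms(1) finite_subset by auto
  have sU: "separable E U k" by (rule separable_subset[OF assms(3) Suc.prems(1) assms(1)])
  have pr: "0 < p ^ r" using assms(4) by simp
  obtain X j where X: "X \<subseteq> U" "card X \<le> k * j" "j = 0 \<or> real j * p ^ r < sum (\<lambda>_. 1) U"
    "\<forall>C \<subseteq> U - X. linked E C \<longrightarrow> sum (\<lambda>_. 1) C \<le> p ^ r"
    by (rule separableE[OF sU, of "\<lambda>_. 1" "p ^ r"]) (use pr in auto)
  have jp: "real j \<le> p"
  proof (cases "j = 0")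
    case False
    then have "real j * p ^ r < p * p ^ r" using X(3) Suc.prems(2) by simp
    then show ?thesis using pr by (simp add: mult_less_cancel_right)
  qed (use assms(4) in simp)
  have fX: "finite X" using X(1) fU finite_subset by auto
  have "\<exists>g. (\<forall>v \<in> U - X. g v < r) \<and>
      (\<forall>C \<subseteq> U - X. \<forall>i. linked E C \<longrightarrow> (\<forall>v \<in> C. g v = i) \<longrightarrow> real (card C) \<le> real k * p)"
  proof (rule levels_of_linked_parts[OF _ assms(2)])
    show "finite (U - X)" using fU by simp
    fix A assume A: "A \<subseteq> U - X" "linked E A"
    have "real (card A) \<le> p ^ r" using X(4) A by simp
    then show "\<exists>g. (\<forall>v \<in> A. g v < r) \<and>
      (\<forall>C \<subseteq> A. \<forall>i. linked E C \<longrightarrow> (\<forall>v \<in> C. g v = i) \<longrightarrow> real (card C) \<le> real k * p)"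
      using Suc.IH[of A] A(1) Suc.prems(1) by blast
  qed
  then obtain g where g: "\<forall>v \<in> U - X. g v < r"
    "\<forall>C \<subseteq> U - X. \<forall>i. linked E C \<longrightarrow> (\<forall>v \<in> C. g v = i) \<longrightarrow> real (card C) \<le> real k * p"
    by (elim exE conjE)
  \<comment> \<open>The removed vertices take level 0 and the levels of the rest shift up by
    one.\<close>
  define f where "f v = (if v \<in> X then 0 else Suc (g v))" for v
  have "real (card C) \<le> real k * p" if C: "C \<subseteq> U" "linked E C" "\<forall>v \<in> C. f v = i" for C i
  proof (cases i)
    case 0
    then have "C \<subseteq> X" using C(3) by (auto simp: f_def split: if_splits)
    then have "card C \<le> k * j" using X(2) fX card_mono le_trans by blast
    then have "real (card C) \<le> real (k * j)" by (simp only: of_nat_le_iff)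
    also have "\<dots> \<le> real k * p" using jp by (simp add: mult_left_mono)
    finally show ?thesis .
  next
    case (Suc i')
    then have "C \<subseteq> U - X" "\<forall>v \<in> C. g v = i'" using C by (auto simp: f_def split: if_splits)
    then show ?thesis using g(2) C(2) by blast
  qed
  moreover have "\<forall>v \<in> U. f v < Suc r" using g(1) by (simp add: f_def)
  ultimately show ?case by blast
qed

section \<open>Balanced separations by one bag\<close>

text \<open>Each vertex of \<open>S\<close> gets weight 1 and the threshold is half the total
  weight, so one bag suffices and no linked set in the rest is heavier than half. Collecting parts
  of the rest then yields a side holding between one and two thirds of \<open>S\<close>.\<close>

lemma balanced_split:
  assumes "separable E V k" "sym E" "finite V" "S \<subseteq> V" "12 * k \<le> card S" "1 \<le> k"
  obtains P Q X where "V = P \<union> Q \<union> X" "P \<inter> Q = {}" "P \<inter> X = {}" "Q \<inter> X = {}" "card X \<le> k"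
    "E \<inter> P \<times> Q = {}" "card S \<le> 3 * card (S \<inter> P)" "3 * card (S \<inter> P) \<le> 2 * card S"
proof -
  define w :: "'a \<Rightarrow> real" where "w v = (if v \<in> S then 1 else 0)" for v
  have w: "sum w C = real (card (S \<inter> C))" if "C \<subseteq> V" for C
  proof -
    have "finite C" using that assms(3) finite_subset by auto
    then show ?thesis unfolding w_def by (simp add: sum.If_cases Int_commute)
  qed
  have fS: "finite S" using assms(3,4) finite_subset by auto
  obtain X j where X: "X \<subseteq> V" "card X \<le> k * j" "j = 0 \<or> real j * (real (card S) / 2) < sum w V"
    "\<forall>C \<subseteq> V - X. linked E C \<longrightarrow> sum w C \<le> real (card S) / 2"
    by (rule separableE[OF assms(1), of w "real (card S) / 2"]) (auto simp: w_def)
  \<comment> \<open>The strict inequality matters: two bags would already require a total weight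
    greater than \<open>card S\<close>.\<close>
  have "j \<le> 1"
  proof (rule ccontr)
    assume "\<not> j \<le> 1"
    then have "2 * (real (card S) / 2) \<le> real j * (real (card S) / 2)"
      by (intro mult_right_mono) auto
    then show False using X(3) w[of V] \<open>\<not> j \<le> 1\<close> assms(4) by (auto simp: Int_absorb2)
  qed
  then have "k * j \<le> k * 1" by (rule mult_le_mono2)
  then have cX: "card X \<le> k" using X(2) by linarith
  \<comment> \<open>A minimal \<open>ok\<close> set is linked, hence light, or splits into two parts lighter than \<open>card S / 3\<close>.\<close>
  define ok where "ok P \<longleftrightarrow> P \<subseteq> V - X \<and> E \<inter> P \<times> (V - X - P) = {} \<and> card S \<le> 3 * card (S \<inter> P)" for P
  have "S \<inter> (V - X) = S - X" using assms(4) by auto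
  moreover have "card S - card X \<le> card (S - X)"
    by (rule diff_card_le_card_Diff) (use X(1) assms(3) finite_subset in auto)
  ultimately have "ok (V - X)" using cX assms(5) by (auto simp: ok_def)
  then obtain P where P: "ok P" "\<And>A. ok A \<Longrightarrow> card P \<le> card A"
    using ex_has_least_nat[of ok "V - X" card] by blast
  have PV: "P \<subseteq> V - X" using P(1) by (simp add: ok_def)
  have fP: "finite P" using PV assms(3) finite_subset by blast
  have "3 * card (S \<inter> P) \<le> 2 * card S"
  proof (cases "linked E P")
    case True
    then have "sum w P \<le> real (card S) / 2" using X(4) PV by blast
    moreover have "sum w P = real (card (S \<inter> P))" by (rule w) (use PV in auto)
    ultimately show ?thesis by linarith
  next
    case False
    then obtain A where A: "A \<subseteq> P" "A \<noteq> {}" "A \<noteq> P" and no: "E \<inter> A \<times> (P - A) = {}"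
      unfolding linked_def by blast
    have no': "E \<inter> (P - A) \<times> A = {}" using no symD[OF assms(2)] by blast
    have out: "E \<inter> P \<times> (V - X - P) = {}" using P(1) by (simp add: ok_def)
    have "card A < card P" using A fP by (simp add: psubset_card_mono psubset_eq)
    then have "\<not> ok A" using P(2)[of A] by linarith
    moreover have "E \<inter> A \<times> (V - X - A) = {}" using out no A(1) by blast
    ultimately have 1: "3 * card (S \<inter> A) < card S" using A(1) PV by (auto simp: ok_def)
    have "card (P - A) < card P" using A fP by (intro psubset_card_mono) auto
    then have "\<not> ok (P - A)" using P(2)[of "P - A"] by linarith
    moreover have "E \<inter> (P - A) \<times> (V - X - (P - A)) = {}" using out no' A(1) by blast
    ultimately have 2: "3 * card (S \<inter> (P - A)) < card S" using PV by (auto simp: ok_def)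
    have "S \<inter> P = (S \<inter> A) \<union> (S \<inter> (P - A))" using A(1) by auto
    then have "card (S \<inter> P) \<le> card (S \<inter> A) + card (S \<inter> (P - A))" by (metis card_Un_le)
    then show ?thesis using 1 2 by linarith
  qed
  then show ?thesis
    using that[of P "V - X - P" X] PV X(1) cX P(1) unfolding ok_def by blast
qed

subsection \<open>Layerings of graphs of bounded degree\<close>

text \<open>Size bound for the first \<open>m\<close> layers in units of
  \<open>card S - 2 * k\<close>, where \<open>S\<close> is the set prescribed for layer 0. Since
  \<open>4 * k \<le> card S\<close>, layer 0 may cost two units in the recursion, and the set
  prescribed for the rest has at most \<open>d * card S\<close> vertices.\<close>

fun layer_growth :: "nat \<Rightarrow> nat \<Rightarrow> nat" where
  "layer_growth d 0 = 0"
| "layer_growth d (Suc m) = 2 * (1 + d * layer_growth d m)"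

lemma layer_growth_le: "1 \<le> d \<Longrightarrow> layer_growth d m \<le> (4 * d) ^ m"
proof (induction m)
  case (Suc m)
  have "1 \<le> d * (4 * d) ^ m" using Suc.prems by simp
  then have "2 * (1 + d * (4 * d) ^ m) \<le> (4 * d) ^ Suc m" by (simp add: algebra_simps)
  moreover have "2 * (1 + d * layer_growth d m) \<le> 2 * (1 + d * (4 * d) ^ m)"
    using Suc by simp
  ultimately show ?case by (metis layer_growth.simps(2) le_trans)
qed simp

text \<open>
  In the recursion a set \<open>S\<close> of between \<open>4k\<close> and \<open>12kd\<close> vertices is prescribed to lie in layer 0. If \<open>S\<close> is
  small, it becomes layer 0 and its neighbourhood is prescribed for the rest; if it is large, it is split by a
  bag \<open>X\<close>, and the layerings of the two sides are glued along \<open>X\<close>. The deduction \<open>- 2 * k\<close> in the size of the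
  initial layers pays for counting \<open>X\<close> in both sides.
\<close>

definition layering ::
    "('a \<times> 'a) set \<Rightarrow> nat \<Rightarrow> nat \<Rightarrow> 'a set \<Rightarrow> 'a set \<Rightarrow> ('a \<Rightarrow> nat) \<Rightarrow> bool" where
  "layering E d k V S l \<longleftrightarrow>
     (\<forall>u \<in> V. \<forall>v \<in> V. (u, v) \<in> E \<longrightarrow> l u \<le> Suc (l v)) \<and>
     (\<forall>v \<in> S. l v = 0) \<and>
     (\<forall>m. card {v \<in> V. l v < m} \<le> layer_growth d m * (card S - 2 * k)) \<and>
     (\<forall>a m C. C \<subseteq> V \<longrightarrow> linked E C \<longrightarrow> (\<forall>v \<in> C. Suc a \<le> l v \<and> l v < Suc a + m) \<longrightarrow>
        card C \<le> layer_growth d m * (12 * k * d))"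

lemma layeringD:
  assumes "layering E d k V S l"
  shows "u \<in> V \<Longrightarrow> v \<in> V \<Longrightarrow> (u, v) \<in> E \<Longrightarrow> l u \<le> Suc (l v)"
    and "v \<in> S \<Longrightarrow> l v = 0"
    and "card {v \<in> V. l v < m} \<le> layer_growth d m * (card S - 2 * k)"
  using assms unfolding layering_def by blast+

text \<open>The window clause of \<open>layering\<close> starts above layer 0, because gluing can
  join linked sets through layer 0. A window containing layer 0 is instead bounded by the total size
  of the first \<open>m\<close> layers.\<close>

lemma layering_window:
  assumes "layering E d k V S l" "finite V" "card S \<le> 12 * k * d"
    and "C \<subseteq> V" "linked E C" "\<And>v. v \<in> C \<Longrightarrow> a \<le> l v \<and> l v < a + m"
  shows "card C \<le> layer_growth d m * (12 * k * d)"
proof (cases a)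
  case 0
  then have "C \<subseteq> {v \<in> V. l v < m}" using assms(4,6) by auto
  then have "card C \<le> card {v \<in> V. l v < m}" using assms(2) by (intro card_mono) auto
  also have "\<dots> \<le> layer_growth d m * (card S - 2 * k)" using layeringD(3)[OF assms(1)] .
  also have "\<dots> \<le> layer_growth d m * (12 * k * d)" using assms(3) by (intro mult_le_mono2) linarith
  finally show ?thesis .
next
  case (Suc a')
  then have "\<forall>v \<in> C. Suc a' \<le> l v \<and> l v < Suc a' + m" using assms(6) by blast
  then show ?thesis using assms(1,4,5) unfolding layering_def by blast
qed

text \<open>Both layerings are 0 on \<open>X\<close>, so they agree there, and every edge lies
  within one of the two sides. A linked set above layer 0 avoids \<open>X\<close>, hence stays in
  \<open>P\<close> or in \<open>Q\<close>.\<close>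

lemma layering_merge:
  assumes l1: "layering E d k (P \<union> X) (S \<inter> P \<union> X) l1" and l2: "layering E d k (Q \<union> X) (S \<inter> Q \<union> X) l2"
    and V: "V = P \<union> Q \<union> X" "P \<inter> Q = {}" "P \<inter> X = {}" "Q \<inter> X = {}" "finite V" "sym E"
    and no: "E \<inter> P \<times> Q = {}" and S: "S \<subseteq> V" and X: "card X \<le> k"
    and size: "2 * k \<le> card (S \<inter> P \<union> X)" "2 * k \<le> card (S \<inter> Q \<union> X)"
  shows "layering E d k V S (\<lambda>v. if v \<in> P then l1 v else l2 v)"
proof -
  let ?l = "\<lambda>v. if v \<in> P then l1 v else l2 v"
  have no': "E \<inter> Q \<times> P = {}" using no symD[OF V(6)] by blast
  have fin: "finite P" "finite Q" "finite X" using V(1,5) by auto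
  have X1: "l1 v = 0" "l2 v = 0" if "v \<in> X" for v
    using that layeringD(2)[OF l1] layeringD(2)[OF l2] by auto
  have P: "?l v = l1 v" if "v \<in> P \<union> X" for v using that V(3) X1 by auto
  have Q: "?l v = l2 v" if "v \<in> Q \<union> X" for v using that V(2,3) X1 by auto
  have lip: "?l u \<le> Suc (?l v)" if uv: "u \<in> V" "v \<in> V" "(u, v) \<in> E" for u v
  proof -
    have "u \<in> P \<union> X \<and> v \<in> P \<union> X \<or> u \<in> Q \<union> X \<and> v \<in> Q \<union> X"
      using uv V(1) no no' by blast
    then show ?thesis
    proof
      assume uv': "u \<in> P \<union> X \<and> v \<in> P \<union> X"
      then have "l1 u \<le> Suc (l1 v)" using layeringD(1)[OF l1 _ _ uv(3)] by blast
      moreover have "?l u = l1 u" "?l v = l1 v" using uv' P by blast+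
      ultimately show ?thesis by (simp only:)
    next
      assume uv': "u \<in> Q \<union> X \<and> v \<in> Q \<union> X"
      then have "l2 u \<le> Suc (l2 v)" using layeringD(1)[OF l2 _ _ uv(3)] by blast
      moreover have "?l u = l2 u" "?l v = l2 v" using uv' Q by blast+
      ultimately show ?thesis by (simp only:)
    qed
  qed
  have zero: "?l v = 0" if "v \<in> S" for v
    using that S V(1) layeringD(2)[OF l1, of v] layeringD(2)[OF l2, of v] by auto
  have count: "card {v \<in> V. ?l v < m} \<le> layer_growth d m * (card S - 2 * k)" for m
  proof -
    have "{v \<in> V. ?l v < m} \<subseteq> {v \<in> P \<union> X. l1 v < m} \<union> {v \<in> Q \<union> X. l2 v < m}"
      using V(1) by auto
    then have "card {v \<in> V. ?l v < m} \<le> card ({v \<in> P \<union> X. l1 v < m} \<union> {v \<in> Q \<union> X. l2 v < m})"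
      by (rule card_mono[rotated]) (use fin in auto)
    also have "\<dots> \<le> card {v \<in> P \<union> X. l1 v < m} + card {v \<in> Q \<union> X. l2 v < m}"
      by (rule card_Un_le)
    also have "\<dots> \<le> layer_growth d m * (card (S \<inter> P \<union> X) - 2 * k) +
        layer_growth d m * (card (S \<inter> Q \<union> X) - 2 * k)"
      by (rule add_mono[OF layeringD(3)[OF l1] layeringD(3)[OF l2]])
    also have "\<dots> = layer_growth d m * (card (S \<inter> P \<union> X) - 2 * k + (card (S \<inter> Q \<union> X) - 2 * k))"
      by (simp add: algebra_simps)
    \<comment> \<open>Counting \<open>X\<close> on both sides adds at most \<open>2 * k\<close>,
      while \<open>2 * k\<close> is deducted twice instead of once. The lower bounds on the two
      prescribed sets keep the subtractions from truncating.\<close>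
    also have "\<dots> \<le> layer_growth d m * (card S - 2 * k)"
    proof (rule mult_le_mono2)
      have "card (S \<inter> P \<union> X) = card (S \<inter> P) + card X" "card (S \<inter> Q \<union> X) = card (S \<inter> Q) + card X"
        using fin V(3,4) by (auto intro!: card_Un_disjoint)
      moreover have "card (S \<inter> P) + card (S \<inter> Q) = card (S \<inter> P \<union> S \<inter> Q)"
        using fin V(2) by (intro card_Un_disjoint[symmetric]) auto
      moreover have "card (S \<inter> P \<union> S \<inter> Q) \<le> card S"
        using finite_subset[OF S V(5)] by (intro card_mono) auto
      ultimately show "card (S \<inter> P \<union> X) - 2 * k + (card (S \<inter> Q \<union> X) - 2 * k) \<le> card S - 2 * k"
        using X size by linarith
    qed
    finally show ?thesis .
  qed
  have window: "card C \<le> layer_growth d m * (12 * k * d)"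
    if C: "C \<subseteq> V" "linked E C" and w: "\<forall>v \<in> C. Suc a \<le> ?l v \<and> ?l v < Suc a + m" for a m C
  proof -
    have "v \<notin> X" if "v \<in> C" for v
    proof
      assume "v \<in> X"
      then have "?l v = 0" using X1 by simp
      then show False using w that by fastforce
    qed
    then have "C \<subseteq> P \<union> Q" using C(1) V(1) by auto
    then have "C \<subseteq> P \<or> C \<subseteq> Q" by (rule linked_subset_cases[OF C(2) _ no V(2)])
    then show ?thesis
    proof
      assume CP: "C \<subseteq> P"
      then have "\<forall>v \<in> C. Suc a \<le> l1 v \<and> l1 v < Suc a + m" using w P[OF UnI1] CP by fastforce
      moreover have "C \<subseteq> P \<union> X" using CP by auto
      ultimately show ?thesis using l1 C(2) unfolding layering_def by blast
    next
      assume CQ: "C \<subseteq> Q"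
      then have "\<forall>v \<in> C. Suc a \<le> l2 v \<and> l2 v < Suc a + m" using w Q[OF UnI1] CQ by fastforce
      moreover have "C \<subseteq> Q \<union> X" using CQ by auto
      ultimately show ?thesis using l2 C(2) unfolding layering_def by blast
    qed
  qed
  show ?thesis
    unfolding layering_def
  proof (intro conjI ballI allI impI, goal_cases)
    case (1 u v)
    then show ?case by (rule lip)
  next
    case (2 v)
    then show ?case by (rule zero)
  next
    case (3 m)
    show ?case by (rule count)
  next
    case (4 a m C)
    then show ?case by (rule window)
  qed
qed

text \<open>Vertices outside \<open>S\<close> with a neighbour in \<open>S\<close> lie in
  \<open>N\<close>, so they are in layer 0 of the rest and in layer 1 of the whole: no edge at
  \<open>S\<close> skips a layer.\<close>

lemma layering_peel:
  assumes l: "layering E d k (V - S) N l" and fin: "finite V" and S: "S \<subseteq> V"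
    and N: "{v \<in> V - S. \<exists>u \<in> S. (u, v) \<in> E} \<subseteq> N" "card N \<le> d * card S" "card N \<le> 12 * k * d"
    and size: "4 * k \<le> card S" "1 \<le> k" and symE: "sym E"
  shows "layering E d k V S (\<lambda>v. if v \<in> S then 0 else Suc (l v))"
proof -
  let ?l = "\<lambda>v. if v \<in> S then 0 else Suc (l v)"
  have lip: "?l u \<le> Suc (?l v)" if uv: "u \<in> V" "v \<in> V" "(u, v) \<in> E" for u v
  proof (cases "u \<in> S")
    case False
    show ?thesis
    proof (cases "v \<in> S")
      case True
      then have "u \<in> N" using N(1) False uv symD[OF symE] by blast
      then show ?thesis using layeringD(2)[OF l] by simp
    next
      case vS: False
      have "u \<in> V - S" "v \<in> V - S" using uv \<open>u \<notin> S\<close> vS by auto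
      then have "l u \<le> Suc (l v)" using layeringD(1)[OF l] uv(3) by blast
      then show ?thesis using \<open>u \<notin> S\<close> vS by simp
    qed
  qed simp
  have count: "card {v \<in> V. ?l v < m} \<le> layer_growth d m * (card S - 2 * k)" for m
  proof (cases m)
    case (Suc m')
    have "{v \<in> V. ?l v < m} \<subseteq> S \<union> {v \<in> V - S. l v < m'}" using Suc by auto
    then have "card {v \<in> V. ?l v < m} \<le> card (S \<union> {v \<in> V - S. l v < m'})"
      by (rule card_mono[rotated]) (use fin S finite_subset in auto)
    also have "\<dots> \<le> card S + card {v \<in> V - S. l v < m'}" by (rule card_Un_le)
    also have "\<dots> \<le> card S + layer_growth d m' * (card N - 2 * k)"
      using layeringD(3)[OF l] by simp
    also have "\<dots> \<le> 2 * (card S - 2 * k) + layer_growth d m' * (d * (2 * (card S - 2 * k)))"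
    proof (intro add_mono mult_le_mono2)
      show "card S \<le> 2 * (card S - 2 * k)" using size(1) by simp
      then have "d * card S \<le> d * (2 * (card S - 2 * k))" by (rule mult_le_mono2)
      then show "card N - 2 * k \<le> d * (2 * (card S - 2 * k))" using N(2) by linarith
    qed
    also have "\<dots> = layer_growth d m * (card S - 2 * k)" using Suc by (simp add: algebra_simps)
    finally show ?thesis .
  qed simp
  have window: "card C \<le> layer_growth d m * (12 * k * d)"
    if C: "C \<subseteq> V" "linked E C" and w: "\<forall>v \<in> C. Suc a \<le> ?l v \<and> ?l v < Suc a + m" for a m C
  \<comment> \<open>Layer \<open>Suc a\<close> of the whole is layer \<open>a\<close> of the rest,
    and \<open>a\<close> may be 0, so the window clause of \<open>l\<close> alone would not
    do.\<close>
  proof (rule layering_window[OF l _ N(3) _ C(2)])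
    show "C \<subseteq> V - S" using C(1) w by (auto split: if_splits)
    show "a \<le> l v \<and> l v < a + m" if "v \<in> C" for v using w that by (auto split: if_splits)
  qed (use fin in auto)
  show ?thesis unfolding layering_def using lip count window by simp
qed

text \<open>End of the recursion: the rest is too small to contain another prescribed set of
  \<open>4 * k\<close> vertices, so it becomes layer 1 as a whole.\<close>

lemma layering_small_rest:
  assumes fin: "finite V" and S: "S \<subseteq> V" and size: "4 * k \<le> card S" "card (V - S) < 4 * k" and d: "1 \<le> d"
  shows "layering E d k V S (\<lambda>v. if v \<in> S then 0 else 1)"
proof -
  let ?l = "\<lambda>v. if v \<in> S then 0 else 1 :: nat"
  have fS: "finite S" using S fin finite_subset by auto
  have grow2: "4 \<le> layer_growth d (Suc (Suc m))" for m
    using d by (simp add: Suc_le_eq)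
  have count: "card {v \<in> V. ?l v < m} \<le> layer_growth d m * (card S - 2 * k)" for m
  proof -
    consider "m = 0" | "m = 1" | m' where "m = Suc (Suc m')" by (metis One_nat_def not0_implies_Suc)
    then show ?thesis
    proof cases
      case 2
      have "{v \<in> V. ?l v < m} \<subseteq> S" using 2 by (auto split: if_splits)
      then have "card {v \<in> V. ?l v < m} \<le> card S" by (rule card_mono[OF fS])
      then show ?thesis using 2 size(1) by simp
    next
      case 3
      have "card {v \<in> V. ?l v < m} \<le> card V" using fin by (intro card_mono) auto
      also have "\<dots> = card S + card (V - S)"
        using card_Un_disjoint[of S "V - S"] S fS fin by (simp add: Un_absorb1)
      \<comment> \<open>This amounts to \<open>12 * k \<le> 3 * card S\<close>, the lower bound on
        \<open>card S\<close> again.\<close>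
      also have "\<dots> \<le> 4 * (card S - 2 * k)" using size by linarith
      also have "\<dots> \<le> layer_growth d m * (card S - 2 * k)" using grow2[of m'] 3 by (intro mult_le_mono1) simp
      finally show ?thesis .
    qed simp
  qed
  have window: "card C \<le> layer_growth d m * (12 * k * d)"
    if C: "C \<subseteq> V" and w: "\<forall>v \<in> C. Suc a \<le> ?l v \<and> ?l v < Suc a + m" for a m C
  proof (cases m)
    case 0
    then have "C = {}" using w by fastforce
    then show ?thesis by simp
  next
    case (Suc m')
    have "C \<subseteq> V - S" using C w by fastforce
    then have "card C \<le> 4 * k" using size(2) fin card_mono[of "V - S" C] by simp
    also have "\<dots> \<le> 1 * (12 * k * 1)" by simp
    also have "\<dots> \<le> layer_growth d m * (12 * k * d)"
      using d Suc by (intro mult_le_mono) auto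
    finally show ?thesis .
  qed
  show ?thesis unfolding layering_def using count window by simp
qed

lemma layering_exists:
  assumes "finite V" "sym E" "separable E V k" "1 \<le> k" "1 \<le> d"
    and deg: "\<And>v. v \<in> V \<Longrightarrow> card {u \<in> V. (v, u) \<in> E} \<le> d"
    and "U \<subseteq> V" "S \<subseteq> U" "4 * k \<le> card S" "card S \<le> 12 * k * d"
  shows "\<exists>l. layering E d k U S l"
  using assms(1,7-10)
proof (induction "card U" arbitrary: U S rule: less_induct)
  case less
  have fU: "finite U" using less.prems(1,2) finite_subset by auto
  have fS: "finite S" using less.prems(3) fU finite_subset by auto
  show ?case
  proof (cases "12 * k \<le> card S")
    case True
    obtain P Q X where PQX: "U = P \<union> Q \<union> X" "P \<inter> Q = {}" "P \<inter> X = {}" "Q \<inter> X = {}" "card X \<le> k"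
      "E \<inter> P \<times> Q = {}" "card S \<le> 3 * card (S \<inter> P)" "3 * card (S \<inter> P) \<le> 2 * card S"
      by (rule balanced_split[OF separable_subset[OF assms(3) less.prems(2) assms(1)] assms(2) fU
            less.prems(3) True assms(4)])
    have fin: "finite P" "finite Q" "finite X" using PQX(1) fU by auto
    have cP: "card (S \<inter> P \<union> X) = card (S \<inter> P) + card X"
      and cQ: "card (S \<inter> Q \<union> X) = card (S \<inter> Q) + card X"
      using fin PQX(3,4) by (auto intro!: card_Un_disjoint)
    have split: "card S = card (S \<inter> P) + card (S \<inter> Q) + card (S \<inter> X)"
    proof -
      have "S = S \<inter> P \<union> S \<inter> Q \<union> S \<inter> X" using less.prems(3) PQX(1) by auto
      then have "card S = card (S \<inter> P \<union> S \<inter> Q \<union> S \<inter> X)" by simp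
      also have "\<dots> = card (S \<inter> P \<union> S \<inter> Q) + card (S \<inter> X)"
        using fin PQX(3,4) by (intro card_Un_disjoint) auto
      also have "card (S \<inter> P \<union> S \<inter> Q) = card (S \<inter> P) + card (S \<inter> Q)"
        using fin PQX(2) by (intro card_Un_disjoint) auto
      finally show ?thesis .
    qed
    have cSX: "card (S \<inter> X) \<le> card X" using fin by (intro card_mono) auto
    \<comment> \<open>Both sides contain vertices of \<open>S\<close>, which makes the recursive
      calls strictly smaller.\<close>
    have "P \<noteq> {}" "Q \<noteq> {}"
      using PQX(5,7,8) split cSX True assms(4) by auto
    then have "P \<union> X \<subset> U" "Q \<union> X \<subset> U" using PQX(1-4) by blast+
    then have less': "card (P \<union> X) < card U" "card (Q \<union> X) < card U"
      using fU by (auto intro: psubset_card_mono)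
    have "\<exists>l. layering E d k (P \<union> X) (S \<inter> P \<union> X) l"
    proof (rule less.hyps[OF less'(1) assms(1)])
      show "P \<union> X \<subseteq> V" using PQX(1) less.prems(2) by auto
      \<comment> \<open>Source of the constant 12: a third of \<open>card S\<close> is then at least
        \<open>4 * k\<close>. Above, two thirds of \<open>card S\<close> plus \<open>k\<close> stay
        within \<open>card S\<close>.\<close>
      show "4 * k \<le> card (S \<inter> P \<union> X)" using cP PQX(7) True by linarith
      show "card (S \<inter> P \<union> X) \<le> 12 * k * d" using cP PQX(5,8) True less.prems(5) by linarith
    qed auto
    moreover have "\<exists>l. layering E d k (Q \<union> X) (S \<inter> Q \<union> X) l"
    proof (rule less.hyps[OF less'(2) assms(1)])
      show "Q \<union> X \<subseteq> V" using PQX(1) less.prems(2) by auto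
      \<comment> \<open>\<open>Q\<close> may hold less than a third of \<open>S\<close> because some
        of it lies in \<open>X\<close>, but adding \<open>X\<close> makes up for that loss.\<close>
      show "4 * k \<le> card (S \<inter> Q \<union> X)" using cQ split cSX PQX(8) True by linarith
      show "card (S \<inter> Q \<union> X) \<le> 12 * k * d" using cQ split PQX(5,7) True less.prems(5) by linarith
    qed auto
    ultimately obtain l1 l2 where "layering E d k (P \<union> X) (S \<inter> P \<union> X) l1"
      "layering E d k (Q \<union> X) (S \<inter> Q \<union> X) l2" by blast
    moreover have "2 * k \<le> card (S \<inter> P \<union> X)" "2 * k \<le> card (S \<inter> Q \<union> X)"
      using cP cQ split cSX PQX(7,8) True by linarith+
    ultimately show ?thesis
      using layering_merge[OF _ _ PQX(1-4) fU assms(2) PQX(6) less.prems(3) PQX(5)] by blast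
  next
    case False
    show ?thesis
    proof (cases "card (U - S) < 4 * k")
      case True
      then show ?thesis using layering_small_rest[OF fU less.prems(3,4) True assms(5)] by blast
    next
      case big: False
      define N where "N = {v \<in> U - S. \<exists>u \<in> S. (u, v) \<in> E}"
      have "card N \<le> card (\<Union>u\<in>S. {v \<in> V. (u, v) \<in> E})"
        by (rule card_mono) (use assms(1) fS less.prems(2) in \<open>auto simp: N_def\<close>)
      also have "\<dots> \<le> (\<Sum>u\<in>S. card {v \<in> V. (u, v) \<in> E})" by (rule card_UN_le[OF fS])
      also have "\<dots> \<le> card S * d"
        using sum_bounded_above[of S "\<lambda>u. card {v \<in> V. (u, v) \<in> E}" d] deg less.prems(2,3) by auto
      finally have cN: "card N \<le> d * card S" by (simp add: mult.commute)
      have dS: "card S \<le> d * card S" using assms(5) by simp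
      have "d * card S \<le> d * (12 * k)" using False by (intro mult_le_mono2) simp
      then have dS12: "d * card S \<le> 12 * k * d" by (simp add: mult.commute)
      have "N \<subseteq> U - S" by (auto simp: N_def)
      moreover have "card N \<le> max (card N) (4 * k)" by simp
      moreover have "max (card N) (4 * k) \<le> card (U - S)"
        using big card_mono[OF _ \<open>N \<subseteq> U - S\<close>] fU by simp
      \<comment> \<open>The neighbourhood is padded to at least \<open>4 * k\<close> vertices to
        meet the lower bound of the recursion. The upper bound survives since
        \<open>4 * k \<le> card S \<le> d * card S\<close>.\<close>
      ultimately obtain N' where N': "N \<subseteq> N'" "N' \<subseteq> U - S" "card N' = max (card N) (4 * k)"
        using exists_subset_between[of N "max (card N) (4 * k)" "U - S"] fU by blast
      have cN': "4 * k \<le> card N'" "card N' \<le> d * card S"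
        using N'(3) cN le_trans[OF less.prems(4) dS] by simp_all
      have "S \<noteq> {}" using less.prems(4) assms(4) by auto
      then have "card (U - S) < card U" using fU less.prems(3) by (intro psubset_card_mono) auto
      then have "\<exists>l. layering E d k (U - S) N' l"
        by (rule less.hyps[OF _ assms(1)]) (use less.prems(2) N'(2) cN' le_trans[OF cN'(2) dS12] in auto)
      then obtain l where "layering E d k (U - S) N' l" by blast
      then have "layering E d k U S (\<lambda>v. if v \<in> S then 0 else Suc (l v))"
        by (rule layering_peel[OF _ fU less.prems(3) _ cN'(2) le_trans[OF cN'(2) dS12]
              less.prems(4) assms(4,2)]) (use N'(1) in \<open>simp add: N_def\<close>)
      then show ?thesis by blast
    qed
  qed
qed

text \<open>Any \<open>4 * k\<close> vertices can start the recursion as layer 0; a smaller graph is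
  a single layer.\<close>

lemma layers_exist:
  assumes "finite V" "sym E" "separable E V k" "1 \<le> k" "1 \<le> d"
    and deg: "\<And>v. v \<in> V \<Longrightarrow> card {u \<in> V. (v, u) \<in> E} \<le> d"
  shows "\<exists>l :: 'a \<Rightarrow> nat. (\<forall>u \<in> V. \<forall>v \<in> V. (u, v) \<in> E \<longrightarrow> l u \<le> Suc (l v)) \<and>
    (\<forall>a m C. C \<subseteq> V \<longrightarrow> linked E C \<longrightarrow> (\<forall>v \<in> C. a \<le> l v \<and> l v < a + m) \<longrightarrow>
      card C \<le> (4 * d) ^ m * (12 * k * d))"
proof (cases "4 * k \<le> card V")
  case True
  then obtain S where S: "S \<subseteq> V" "card S = 4 * k" using assms(1) obtain_subset_with_card_n by metis
  have "card S \<le> 12 * k * d" using S(2) assms(5) mult_le_mono[of "4 * k" "12 * k" 1 d] by simp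
  moreover from this obtain l where l: "layering E d k V S l"
    using layering_exists[OF assms(1-5) deg order_refl S(1)] S(2) by auto
  ultimately have "card C \<le> (4 * d) ^ m * (12 * k * d)"
    if "C \<subseteq> V" "linked E C" "\<forall>v \<in> C. a \<le> l v \<and> l v < a + m" for a m C
    using layering_window[OF l assms(1) _ that(1,2), of a m] that(3)
      mult_le_mono1[OF layer_growth_le[OF assms(5), of m], of "12 * k * d"] le_trans by blast
  then show ?thesis using layeringD(1)[OF l] by blast
next
  case False
  have "card C \<le> (4 * d) ^ m * (12 * k * d)" if "C \<subseteq> V" for m C
  proof -
    have "card C \<le> 4 * k" using card_mono[OF assms(1) that] False by simp
    also have "\<dots> \<le> 1 * (12 * k * 1)" by simp
    also have "\<dots> \<le> (4 * d) ^ m * (12 * k * d)" using assms(5) by (intro mult_le_mono) auto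
    finally show ?thesis .
  qed
  then show ?thesis by (intro exI[of _ "\<lambda>_. 0"]) auto
qed

subsection \<open>Treewidth and connectedness\<close>

text \<open>A set that no edge leaves contains everything reachable from its elements.\<close>

lemma linked_strongly_connected:
  assumes "strongly_connected H" "arcs_ends H \<subseteq> E"
  shows "linked E (verts H)"
  unfolding linked_def
proof (intro allI impI, rule ccontr)
  fix A assume A: "A \<subseteq> verts H" "A \<noteq> {}" "A \<noteq> verts H"
    and no: "\<not> (\<exists>a\<in>A. \<exists>b\<in>verts H - A. (a, b) \<in> E)"
  obtain a b where ab: "a \<in> A" "b \<in> verts H" "b \<notin> A" using A by auto
  have "(a, b) \<in> rtrancl_on (verts H) (arcs_ends H)"
    using assms(1) ab A(1) unfolding strongly_connected_def reachable_def by blast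
  then have "b \<in> A"
  proof (induction rule: rtrancl_on_induct)
    case (step y z)
    then show ?case using no assms(2) by blast
  qed (use ab in simp)
  then show False using ab(3) by simp
qed

lemma sym_parcs: "pair_graph G \<Longrightarrow> sym (parcs G)"
proof -
  assume "pair_graph G"
  then interpret pair_graph G .
  show ?thesis using pair_sym_arcs by (simp add: symmetric_def)
qed

lemma parcs_subset: "pair_graph G \<Longrightarrow> parcs G \<subseteq> pverts G \<times> pverts G"
proof -
  assume "pair_graph G"
  then interpret pair_graph G .
  show ?thesis using in_arcsD1 in_arcsD2 by auto
qed

lemma finite_pverts: "pair_graph G \<Longrightarrow> finite (pverts G)"
proof -
  assume "pair_graph G"
  then interpret pair_graph G .
  show ?thesis by (rule pair_finite_verts)
qed

lemma linked_connected:
  assumes "Digraph_Component.connected G" "tail G = fst" "head G = snd" "arcs G \<subseteq> E" "sym E"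
  shows "linked E (verts G)" "verts G \<noteq> {}"
proof -
  have sc: "strongly_connected (with_proj (mk_symmetric G))"
    using assms(1) by (simp add: connected_def)
  have "parcs (mk_symmetric G) \<subseteq> E"
    using assms(2-4) symD[OF assms(5)] by (fastforce simp: mk_symmetric_def)
  then have "linked E (verts (with_proj (mk_symmetric G)))"
    using linked_strongly_connected[OF sc] by simp
  then show "linked E (verts G)" by (simp add: mk_symmetric_def)
  show "verts G \<noteq> {}" using sc by (simp add: strongly_connected_def mk_symmetric_def)
qed

section \<open>Acyclic connected graphs as grown trees\<close>

lemma pawalk_append_arc:
  "pcas u P v \<Longrightarrow> pcas u (P @ [(v, n)]) n \<and> pawalk_verts u (P @ [(v, n)]) = pawalk_verts u P @ [n]"
  by (induction P arbitrary: u) auto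

text \<open>Supplies the simple path inside \<open>N\<close> that would close a cycle if a new node
  had two neighbours in \<open>N\<close>.\<close>

lemma grown_tree_path:
  assumes "grown_tree F N" "sym F" "u \<in> N" "v \<in> N"
  shows "\<exists>P. pcas u P v \<and> set P \<subseteq> F \<and> distinct (pawalk_verts u P) \<and> set (pawalk_verts u P) \<subseteq> N"
  using assms
proof (induction arbitrary: u v rule: grown_tree.induct)
  case (root r)
  then show ?case by (intro exI[of _ "[]"]) auto
next
  case (leaf N n p)
  note path = leaf(6)[OF leaf(7)]
  consider "u = n" "v = n" | "u = n" "v \<in> N" | "u \<in> N" "v = n" | "u \<in> N" "v \<in> N"
    using leaf(8,9) by blast
  then show ?case
  proof cases
    case 1
    then show ?thesis by (intro exI[of _ "[]"]) auto
  next
    case 2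
    obtain P where "pcas p P v" "set P \<subseteq> F" "distinct (pawalk_verts p P)" "set (pawalk_verts p P) \<subseteq> N"
      using path[OF leaf(3) 2(2)] by blast
    then show ?thesis using 2 leaf(2,4) by (intro exI[of _ "(n, p) # P"]) auto
  next
    case 3
    obtain P where P: "pcas u P p" "set P \<subseteq> F" "distinct (pawalk_verts u P)" "set (pawalk_verts u P) \<subseteq> N"
      using path[OF 3(1) leaf(3)] by blast
    then show ?thesis using 3 leaf(2) symD[OF leaf(7,4)] pawalk_append_arc[OF P(1), of n]
      by (intro exI[of _ "P @ [(p, n)]"]) auto
  next
    case 4
    obtain P where "pcas u P v" "set P \<subseteq> F" "distinct (pawalk_verts u P)" "set (pawalk_verts u P) \<subseteq> N"
      using path[OF 4] by blast
    then show ?thesis by (intro exI[of _ P]) auto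
  qed
qed

text \<open>Connectedness provides a new node adjacent to the part grown so far, and acyclicity
  makes its neighbour there unique.\<close>

lemma undirected_tree_grown:
  assumes "undirected_tree T"
  shows "grown_tree (parcs T) (pverts T)"
proof -
  have T: "pair_graph T" "Digraph_Component.connected (with_proj T)"
    "\<And>p. pre_digraph.cycle (with_proj T) p \<Longrightarrow> length p < 3"
    using assms unfolding undirected_tree_def by (auto simp: not_le)
  note symT = sym_parcs[OF T(1)]
  have lnk: "linked (parcs T) (pverts T)" and ne: "pverts T \<noteq> {}"
    using linked_connected[OF T(2), of "parcs T"] symT by auto
  have "grown_tree (parcs T) (pverts T)" if "grown_tree (parcs T) N" "N \<subseteq> pverts T" "N \<noteq> {}" for N
    using that
  proof (induction "card (pverts T - N)" arbitrary: N rule: less_induct)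
    case less
    show ?case
    proof (cases "N = pverts T")
      case False
      then obtain p n where pn: "p \<in> N" "n \<in> pverts T - N" "(p, n) \<in> parcs T"
        using linkedD[OF lnk less.prems(2,3)] by blast
      have np: "(n, p) \<in> parcs T" using symD[OF symT pn(3)] .
      have uniq: "q = p" if q: "q \<in> N" "(n, q) \<in> parcs T \<or> (q, n) \<in> parcs T" for q
      proof (rule ccontr)
        assume "q \<noteq> p"
        have qn: "(q, n) \<in> parcs T" using q(2) symD[OF symT] by blast
        obtain P where P: "pcas p P q" "set P \<subseteq> parcs T" "distinct (pawalk_verts p P)"
          "set (pawalk_verts p P) \<subseteq> N"
          using grown_tree_path[OF less.prems(1) symT pn(1) q(1)] by blast
        \<comment> \<open>From \<open>n\<close> to \<open>p\<close>, along the path to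
          \<open>q\<close>, and back to \<open>n\<close>. As \<open>q\<close> differs from
          \<open>p\<close>, the path has an arc, which gives the length 3 that counts as an
          undirected cycle.\<close>
        let ?c = "(n, p) # P @ [(q, n)]"
        have "P \<noteq> []" using P(1) \<open>q \<noteq> p\<close> by auto
        then have len: "3 \<le> length ?c" by (cases P) auto
        have "pre_digraph.awalk (with_proj T) n ?c n"
          unfolding pre_digraph.awalk_def cas_with_proj_eq
          using pn(2) np qn P(2) pawalk_append_arc[OF P(1), of n] by auto
        moreover have "distinct (tl (pre_digraph.awalk_verts (with_proj T) n ?c))"
          unfolding awalk_verts_with_proj_eq
          using P(3,4) pn(2) pawalk_append_arc[OF P(1), of n] by auto
        ultimately have "pre_digraph.cycle (with_proj T) ?c"
          unfolding pre_digraph.cycle_def by blast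
        then show False using T(3)[of ?c] len by linarith
      qed
      have "pverts T - insert n N \<subset> pverts T - N" using pn(2) by blast
      then have "card (pverts T - insert n N) < card (pverts T - N)"
        using finite_pverts[OF T(1)] by (intro psubset_card_mono) auto
      moreover have "grown_tree (parcs T) (insert n N)"
        by (rule grown_tree.leaf[OF less.prems(1) _ pn(1) np]) (use pn(2) uniq in blast)+
      ultimately show ?thesis using less.hyps pn(2) less.prems(2) by blast
    qed (use less.prems in simp)
  qed
  moreover obtain r where "r \<in> pverts T" using ne by auto
  ultimately show ?thesis using grown_tree.root[of "parcs T" r] by blast
qed

text \<open>A decomposition attaining the treewidth has bags of at most \<open>t + 1\<close>
  vertices, and its tree can be grown leaf by leaf.\<close>

lemma separable_treewidth:
  assumes G: "pair_graph G" and t: "treewidth G \<le> t"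
  shows "separable (parcs G) (pverts G) (t + 1)"
proof -
  let ?T = "\<lparr>pverts = {0 :: nat}, parcs = {}\<rparr>"
  have single: "Digraph_Component.connected H" if "verts H = {0 :: nat}" for H :: "(nat, nat \<times> nat) pre_digraph"
    using that by (auto simp: connected_def strongly_connected_def mk_symmetric_def reachable_def)
  have "pair_graph ?T" by unfold_locales (auto simp: symmetric_def sym_def)
  moreover have "\<not> pre_digraph.cycle (with_proj ?T) p" for p
    unfolding pre_digraph.cycle_def pre_digraph.awalk_def by auto
  ultimately have "undirected_tree ?T"
    unfolding undirected_tree_def using single[of "with_proj ?T"] by simp
  moreover have "Digraph_Component.connected (with_proj ?T \<restriction> {x \<in> pverts ?T. v \<in> pverts G})"
    if "v \<in> pverts G" for v
    by (rule single) (use that in auto)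
  ultimately have "tree_decomposition G ?T (\<lambda>_. pverts G)"
    unfolding tree_decomposition_def using parcs_subset[OF G] by auto
  \<comment> \<open>Without some decomposition, \<^const>\<open>Least\<close> would be arbitrary.\<close>
  then have "\<exists>k. \<exists>(T :: nat pair_pre_digraph) B. tree_decomposition G T B \<and> decomposition_width T B = k"
    by blast
  then have "\<exists>(T :: nat pair_pre_digraph) B. tree_decomposition G T B \<and> decomposition_width T B = treewidth G"
    unfolding treewidth_def by (rule LeastI_ex)
  then obtain T :: "nat pair_pre_digraph" and B
    where TB: "tree_decomposition G T B" "decomposition_width T B \<le> t" using t by metis
  have T: "undirected_tree T" and sub: "\<forall>x \<in> pverts T. B x \<subseteq> pverts G"
    and edge: "\<forall>(u, v) \<in> parcs G. \<exists>x \<in> pverts T. u \<in> B x \<and> v \<in> B x"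
    and conn: "\<forall>v \<in> pverts G. Digraph_Component.connected (with_proj T \<restriction> {x \<in> pverts T. v \<in> B x})"
    using TB(1) unfolding tree_decomposition_def by blast+
  have pT: "pair_graph T" using T by (simp add: undirected_tree_def)
  note symT = sym_parcs[OF pT]
  show ?thesis
  proof (rule separable_of_bags[OF undirected_tree_grown[OF T] symT finite_pverts[OF G]])
    fix x assume x: "x \<in> pverts T"
    then show "B x \<subseteq> pverts G" using sub by blast
    have "card (B x) \<le> Max ((\<lambda>x. card (B x)) ` pverts T)"
      using finite_pverts[OF pT] x by (intro Max_ge) auto
    then show "card (B x) \<le> t + 1" using TB(2) unfolding decomposition_width_def by linarith
  next
    fix u v assume "(u, v) \<in> parcs G"
    then show "\<exists>x \<in> pverts T. u \<in> B x \<and> v \<in> B x" using edge by blast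
  next
    fix v assume "v \<in> pverts G"
    then have c: "Digraph_Component.connected (with_proj T \<restriction> {x \<in> pverts T. v \<in> B x})" using conn by blast
    show "{x \<in> pverts T. v \<in> B x} \<noteq> {}" "linked (parcs T) {x \<in> pverts T. v \<in> B x}"
      using linked_connected[OF c _ _ _ symT] by auto
  qed
qed

lemma card_neighbours_le_max_degree:
  assumes "pair_graph G" "v \<in> pverts G"
  shows "card {u \<in> pverts G. (v, u) \<in> parcs G} \<le> max_degree G"
proof -
  interpret pair_graph G by (rule assms(1))
  have "card {u \<in> pverts G. (v, u) \<in> parcs G} = card (Pair v ` {u \<in> pverts G. (v, u) \<in> parcs G})"
    by (rule card_image[symmetric]) (simp add: inj_on_def)
  also have "\<dots> \<le> out_degree (with_proj G) v"
    unfolding out_degree_def out_arcs_def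
    by (rule card_mono) (auto intro: finite_subset[OF _ pair_finite_arcs])
  also have "\<dots> \<le> max_degree G"
    unfolding max_degree_def using assms(2) pair_finite_verts by (intro Max_ge) auto
  finally show ?thesis .
qed

text \<open>Reduces clustering to linked sets of one colour: a monochromatic component is strongly
  connected, hence linked.\<close>

lemma clustering_at_mostI:
  assumes "\<And>C i. C \<subseteq> pverts G \<Longrightarrow> (\<And>v. v \<in> C \<Longrightarrow> f v = i) \<Longrightarrow> linked (parcs G) C \<Longrightarrow> real (card C) \<le> k"
  shows "clustering_at_most G f k"
  unfolding clustering_at_most_def
proof
  fix H assume "H \<in> monochromatic_components G f"
  then obtain i where "H \<in> pre_digraph.sccs (with_proj G \<restriction> {v \<in> pverts G. f v = i})"
    unfolding monochromatic_components_def by blast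
  then have sub: "subgraph H (with_proj G \<restriction> {v \<in> pverts G. f v = i})" and sc: "strongly_connected H"
    by (auto simp: pre_digraph.sccs_def induced_subgraph_def)
  then have V: "verts H \<subseteq> {v \<in> pverts G. f v = i}" and "arcs H \<subseteq> parcs G" "tail H = fst" "head H = snd"
    by (auto simp: subgraph_def compatible_def)
  then have "arcs_ends H \<subseteq> parcs G" by (auto simp: arcs_ends_def arc_to_ends_def)
  then have "linked (parcs G) (verts H)" by (rule linked_strongly_connected[OF sc])
  then show "real (card (verts H)) \<le> k" using V by (intro assms[of "verts H" i]) auto
qed

subsection \<open>Colouring the product\<close>

lemma linked_strong_product:
  assumes "linked (parcs (G \<boxtimes> H)) C"
  shows "linked (parcs G) (fst ` C)" "linked (parcs H) (snd ` C)"
  by (rule linked_image[OF assms]; auto simp: strong_product_def)+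

lemma card_product_le:
  assumes "finite C"
  shows "card C \<le> card (fst ` C) * card (snd ` C)"
proof -
  have "card C \<le> card (fst ` C \<times> snd ` C)"
    by (rule card_mono) (use assms subset_fst_snd in auto)
  then show ?thesis by (simp add: card_cartesian_product)
qed

text \<open>
  Level \<open>i\<close> changes its colour at the layers congruent to \<open>i\<close> modulo \<open>m\<close>; \<open>block_start m i l\<close> is the last such
  layer up to \<open>l\<close>. As the \<open>m\<close> levels have different residues, blocks of all levels are identified by their
  start, and colouring them by the start modulo \<open>m + 1\<close> separates any two that meet or touch.
\<close>

definition block_start :: "nat \<Rightarrow> nat \<Rightarrow> nat \<Rightarrow> int" where
  "block_start m i l = int l - (int l - int i) mod int m"

lemma block_start_bounds:
  assumes "1 \<le> m"
  shows "block_start m i l \<le> int l" "int l < block_start m i l + int m"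
  using assms by (simp_all add: block_start_def)

lemma block_start_level:
  assumes "i < m"
  shows "i = nat (block_start m i l mod int m)"
proof -
  have "block_start m i l mod int m = int i mod int m"
    unfolding block_start_def by (metis add_diff_cancel_left' diff_add_cancel mod_diff_right_eq)
  then show ?thesis using assms by simp
qed

text \<open>Each start lies less than \<open>m\<close> below its layer and not above it, and the
  layers differ by at most one. So the starts differ by less than \<open>m + 1\<close>, and
  congruence forces equality.\<close>

lemma block_start_eq:
  assumes "1 \<le> m" "l \<le> Suc l'" "l' \<le> Suc l"
    and "block_start m i l mod (int m + 1) = block_start m i' l' mod (int m + 1)"
  shows "block_start m i l = block_start m i' l'"
proof -
  let ?d = "block_start m i l - block_start m i' l'"
  have "(int m + 1) dvd ?d" using assms(4) by (simp add: mod_eq_dvd_iff)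
  moreover have "\<bar>?d\<bar> < int m + 1"
    using block_start_bounds[OF assms(1), where i = i and l = l]
      block_start_bounds[OF assms(1), where i = i' and l = l'] assms(2,3)
    by linarith
  ultimately have "?d = 0" by (metis abs_of_nonneg dvd_imp_le_int not_le add_nonneg_nonneg of_nat_0_le_iff zero_le_one)
  then show ?thesis by simp
qed

section \<open>Balancing the exponents\<close>

text \<open>Trade \<open>n2 powr (1 / c)\<close> for a full factor \<open>n = n1 * n2\<close> under
  the root and bound the remaining power of \<open>n2\<close>. The exponent comes out as
  \<open>c / D\<close> because \<open>D + c - 1 = c ^ 2\<close>.\<close>

lemma thin_product_bound:
  fixes n1 n2 :: real
  assumes "1 \<le> n1" "1 \<le> n2" "1 \<le> c" and D: "D = real c ^ 2 - real c + 1"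
    and thin: "n2 \<le> (n1 * n2) powr (1 / D)"
  shows "n1 powr (1 / real c) * n2 \<le> (n1 * n2) powr (real c / D)"
proof -
  have "0 \<le> real c * (real c - 1)" using assms(3) by simp
  then have D0: "0 < D" unfolding D by (simp add: power2_eq_square algebra_simps)
  have c1: "0 \<le> 1 - 1 / real c" using assms(3) by simp
  have "n1 powr (1 / real c) * n2 = n1 powr (1 / real c) * (n2 powr (1 / real c) * n2 powr (1 - 1 / real c))"
    using assms(2) by (simp add: powr_add[symmetric])
  also have "\<dots> = (n1 * n2) powr (1 / real c) * n2 powr (1 - 1 / real c)"
    using assms(1,2) by (simp add: powr_mult)
  also have "\<dots> \<le> (n1 * n2) powr (1 / real c) * ((n1 * n2) powr (1 / D)) powr (1 - 1 / real c)"
    using assms(2) thin c1 by (intro mult_left_mono powr_mono2) auto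
  also have "\<dots> = (n1 * n2) powr (1 / real c + 1 / D * (1 - 1 / real c))"
    by (simp add: powr_add powr_powr)
  also have "1 / real c + 1 / D * (1 - 1 / real c) = real c / D"
    using D0 assms(3) D by (simp add: field_simps power2_eq_square)
  finally show ?thesis .
qed

text \<open>A large \<open>n2\<close> forces \<open>n1\<close> to be at most
  \<open>n powr (1 - 1 / D)\<close> with \<open>n = n1 * n2\<close>, and
  \<open>D - 1 = c * (c - 1)\<close>. Thus the threshold \<open>n powr (1 / D)\<close> gives the
  exponent \<open>c / D\<close> on both of its sides.\<close>

lemma thick_product_bound:
  fixes n1 n2 :: real
  assumes "1 \<le> n1" "1 \<le> n2" "2 \<le> c" and D: "D = real c ^ 2 - real c + 1"
    and thick: "(n1 * n2) powr (1 / D) < n2"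
  shows "n1 powr (1 / (real c - 1)) \<le> (n1 * n2) powr (real c / D)"
proof -
  have "0 \<le> real c * (real c - 1)" using assms(3) by simp
  then have D0: "0 < D" unfolding D by (simp add: power2_eq_square algebra_simps)
  let ?n = "n1 * n2"
  have n0: "0 < ?n" using assms(1,2) by simp
  have "n1 * ?n powr (1 / D) \<le> ?n" using thick assms(1) by (intro mult_left_mono) auto
  moreover have "0 < ?n powr (1 / D)" using assms(1,2) by simp
  ultimately have "n1 \<le> ?n / ?n powr (1 / D)" by (rule pos_le_divide_eq[THEN iffD2, rotated])
  also have "\<dots> = ?n powr (1 - 1 / D)" using n0 by (simp add: powr_diff)
  finally have "n1 powr (1 / (real c - 1)) \<le> (?n powr (1 - 1 / D)) powr (1 / (real c - 1))"
    using assms(1,3) by (intro powr_mono2) auto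
  also have "\<dots> = ?n powr ((1 - 1 / D) * (1 / (real c - 1)))" by (simp add: powr_powr)
  also have "(1 - 1 / D) * (1 / (real c - 1)) = real c / D"
  proof -
    have "1 - 1 / D = real c * (real c - 1) / D"
      using D0 D by (simp add: field_simps power2_eq_square)
    then show ?thesis using assms(3) by simp
  qed
  finally show ?thesis .
qed

theorem theorem20:
  fixes t c \<Delta> :: nat
    and H1 :: "'a pair_pre_digraph"
    and H2 :: "'b pair_pre_digraph"
  assumes "t \<ge> 1" and "c \<ge> 1" and "\<Delta> \<ge> 1"
    and "pair_graph H1" and "treewidth H1 \<le> t"
    and "pair_graph H2" and "treewidth H2 \<le> t" and "max_degree H2 \<le> \<Delta>"
  shows "\<exists>f :: 'a \<times> 'b \<Rightarrow> nat.
    uses_at_most_colours (H1 \<boxtimes> H2) f c \<and>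
    clustering_at_most (H1 \<boxtimes> H2) f
      (6 ^ (c + 1) * (real t + 1) ^ 2 * real \<Delta> ^ c *
        real (card (pverts (H1 \<boxtimes> H2))) powr (real c / (real c ^ 2 - real c + 1)))"
proof -
  define V1 where "V1 = pverts H1"
  define V2 where "V2 = pverts H2"
  define n1 where "n1 = real (card V1)"
  define n2 where "n2 = real (card V2)"
  define D where "D = real c ^ 2 - real c + 1"
  define M where "M = (n1 * n2) powr (real c / D)"
  define K where "K = 6 ^ (c + 1) * (real t + 1) ^ 2 * real \<Delta> ^ c"
  have fin: "finite V1" "finite V2"
    unfolding V1_def V2_def by (rule finite_pverts; fact)+
  have V: "pverts (H1 \<boxtimes> H2) = V1 \<times> V2" by (simp add: strong_product_def V1_def V2_def)
  have M_eq: "real (card (pverts (H1 \<boxtimes> H2))) powr (real c / (real c ^ 2 - real c + 1)) = M"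
    unfolding V by (simp add: card_cartesian_product M_def n1_def n2_def D_def)
  note sep1 = separable_treewidth[OF assms(4,5), folded V1_def]
  note sep2 = separable_treewidth[OF assms(6,7), folded V2_def]
  note sym1 = sym_parcs[OF assms(4)]
  note sym2 = sym_parcs[OF assms(6)]
  have "\<exists>f :: 'a \<times> 'b \<Rightarrow> nat. (\<forall>z. f z < c) \<and> (\<forall>C \<subseteq> V1 \<times> V2. \<forall>i. (\<forall>v \<in> C. f v = i) \<longrightarrow>
      linked (parcs (H1 \<boxtimes> H2)) C \<longrightarrow> real (card C) \<le> K * M)"
  proof (cases "V1 = {} \<or> V2 = {}")
    case True
    then show ?thesis using assms(2) by (intro exI[of _ "\<lambda>_. 0"]) (auto simp: K_def M_def)
  next
    case False
    then have pos: "1 \<le> n1" "1 \<le> n2"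
      using fin by (auto simp: n1_def n2_def Suc_le_eq card_gt_0_iff)
    have K0: "0 \<le> K" by (simp add: K_def)
    show ?thesis
    proof (cases "n2 \<le> (n1 * n2) powr (1 / D)")
      case True
      define p where "p = n1 powr (1 / real c)"
      have p: "0 < p" using pos by (simp add: p_def)
      have "p ^ c = n1" using pos assms(2) by (simp add: p_def powr_power)
      then obtain g where g: "\<forall>v \<in> V1. g v < c"
        "\<forall>C \<subseteq> V1. \<forall>i. linked (parcs H1) C \<longrightarrow> (\<forall>v \<in> C. g v = i) \<longrightarrow> real (card C) \<le> real (t + 1) * p"
        using levels_exist[OF fin(1) sym1 sep1 p _ assms(2) order_refl] unfolding n1_def by auto
      have "real (card C) \<le> K * M"
        if C: "C \<subseteq> V1 \<times> V2" "\<forall>z \<in> C. g (fst z) = i" "linked (parcs (H1 \<boxtimes> H2)) C" for C i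
      proof -
        have fC: "finite C" using C(1) fin finite_subset by blast
        have "fst ` C \<subseteq> V1" "\<forall>v \<in> fst ` C. g v = i" using C(1,2) by auto
        then have "real (card (fst ` C)) \<le> real (t + 1) * p"
          using g(2) linked_strong_product(1)[OF C(3)] by blast
        moreover have "card (snd ` C) \<le> card V2" using C(1) fin(2) by (intro card_mono) auto
        then have "real (card (snd ` C)) \<le> n2" by (simp add: n2_def)
        ultimately have "real (card (fst ` C)) * real (card (snd ` C)) \<le> real (t + 1) * p * n2"
          by (intro mult_mono) (use p in auto)
        moreover have "real (card C) \<le> real (card (fst ` C)) * real (card (snd ` C))"
          using card_product_le[OF fC] by (metis of_nat_le_iff of_nat_mult)
        ultimately have "real (card C) \<le> real (t + 1) * (p * n2)" by (simp add: mult.assoc)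
        also have "\<dots> \<le> K * M"
        proof (rule mult_mono)
          show "p * n2 \<le> M"
            using thin_product_bound[OF pos assms(2) D_def True] by (simp add: p_def M_def)
          have "real (t + 1) * 1 * 1 \<le> (real t + 1) ^ 2 * 6 ^ (c + 1) * real \<Delta> ^ c"
            using assms(3) by (intro mult_mono one_le_power) (auto simp: power2_eq_square algebra_simps)
          then show "real (t + 1) \<le> K" by (simp add: K_def mult_ac)
        qed (use K0 p pos in auto)
        finally show ?thesis .
      qed
      note bound = this
      show ?thesis
      \<comment> \<open>The default 0 keeps the values below \<open>c\<close> outside
        \<open>V1\<close>, where \<open>g\<close> is arbitrary.\<close>
      proof (intro exI[of _ "\<lambda>z. if g (fst z) < c then g (fst z) else 0"] conjI allI impI)
        show "(if g (fst z) < c then g (fst z) else 0) < c" for z :: "'a \<times> 'b"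
          using assms(2) by simp
        fix C :: "('a \<times> 'b) set" and i
        assume C: "C \<subseteq> V1 \<times> V2" "\<forall>z \<in> C. (if g (fst z) < c then g (fst z) else 0) = i"
          "linked (parcs (H1 \<boxtimes> H2)) C"
        have "g (fst z) < c" if "z \<in> C" for z using g(1) C(1) that by auto
        then have "\<forall>z \<in> C. g (fst z) = i" using C(2) by simp
        then show "real (card C) \<le> K * M" using bound[OF C(1) _ C(3)] by blast
      qed
    next
      case False
      \<comment> \<open>For \<open>c = 1\<close> the threshold is \<open>n1 * n2\<close>, which
        \<open>n2\<close> cannot exceed. So at least one level remains after sparing a
        colour.\<close>
      have c2: "2 \<le> c"
      proof (rule ccontr)
        assume "\<not> 2 \<le> c"
        then have "c = 1" using assms(2) by simp
        then have "(n1 * n2) powr (1 / D) = n1 * n2" using pos by (simp add: D_def)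
        moreover have "1 * n2 \<le> n1 * n2" using pos by (intro mult_right_mono) auto
        ultimately show False using False by simp
      qed
      define m where "m = c - 1"
      have m: "1 \<le> m" "c = Suc m" "real m = real c - 1" using c2 by (auto simp: m_def)
      define p where "p = n1 powr (1 / real m)"
      have p: "0 < p" using pos by (simp add: p_def)
      have "p ^ m = n1" using pos m(1) by (simp add: p_def powr_power)
      then obtain g where g: "\<forall>v \<in> V1. g v < m"
        "\<forall>C \<subseteq> V1. \<forall>i. linked (parcs H1) C \<longrightarrow> (\<forall>v \<in> C. g v = i) \<longrightarrow> real (card C) \<le> real (t + 1) * p"
        using levels_exist[OF fin(1) sym1 sep1 p _ m(1) order_refl] unfolding n1_def by auto
      have deg: "card {u \<in> V2. (v, u) \<in> parcs H2} \<le> \<Delta>" if "v \<in> V2" for v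
        using card_neighbours_le_max_degree[OF assms(6), of v] that assms(8) unfolding V2_def by linarith
      have "1 \<le> t + 1" by simp
      then obtain l where l: "\<forall>u \<in> V2. \<forall>v \<in> V2. (u, v) \<in> parcs H2 \<longrightarrow> l u \<le> Suc (l v)"
        "\<forall>a m C. C \<subseteq> V2 \<longrightarrow> linked (parcs H2) C \<longrightarrow> (\<forall>v \<in> C. a \<le> l v \<and> l v < a + m) \<longrightarrow>
          card C \<le> (4 * \<Delta>) ^ m * (12 * (t + 1) * \<Delta>)"
        using layers_exist[OF fin(2) sym2 sep2 _ assms(3) deg] by blast
      define s where "s z = block_start m (g (fst z)) (l (snd z))" for z
      define f where "f z = nat (s z mod (int m + 1))" for z
      have "real (card C) \<le> K * M"
        if C: "C \<subseteq> V1 \<times> V2" "\<forall>z \<in> C. f z = i" "linked (parcs (H1 \<boxtimes> H2)) C" for C i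
      proof (cases "C = {}")
        case True
        then show ?thesis using K0 by (simp add: M_def)
      next
        case False
        then obtain z0 where z0: "z0 \<in> C" by auto
        have fC: "finite C" using C(1) fin finite_subset by blast
        \<comment> \<open>Equal colours only give congruent starts; along an edge they give equal
          starts, and linkedness spreads this over \<open>C\<close>. The common start then
          determines the level, as its residue modulo \<open>m\<close>, and the window of
          \<open>m\<close> layers.\<close>
        have s_eq: "s z = s z0" if "z \<in> C" for z
        proof (rule linked_const[OF C(3) _ that z0])
          fix a b assume ab: "a \<in> C" "b \<in> C" "(a, b) \<in> parcs (H1 \<boxtimes> H2)"
          have "snd a = snd b \<or> (snd a, snd b) \<in> parcs H2 \<and> (snd b, snd a) \<in> parcs H2"
            using ab(3) symD[OF sym2] by (auto simp: strong_product_def)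
          moreover have "snd a \<in> V2" "snd b \<in> V2" using ab(1,2) C(1) by auto
          ultimately have "l (snd a) \<le> Suc (l (snd b))" "l (snd b) \<le> Suc (l (snd a))"
            using l(1) by auto
          moreover have "nat (s a mod (int m + 1)) = nat (s b mod (int m + 1))"
            using C(2) ab(1,2) unfolding f_def by simp
          then have "s a mod (int m + 1) = s b mod (int m + 1)"
            by (subst (asm) eq_nat_nat_iff) auto
          ultimately show "s a = s b" unfolding s_def by (rule block_start_eq[OF m(1)])
        qed
        have "\<forall>v \<in> fst ` C. g v = nat (s z0 mod int m)"
        proof
          fix v assume v: "v \<in> fst ` C"
          obtain z where z: "z \<in> C" "v = fst z" using v by blast
          then have "g v < m" using g(1) C(1) by auto
          from block_start_level[OF this, of "l (snd z)"] show "g v = nat (s z0 mod int m)"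
            using s_eq[OF z(1)] z(2) unfolding s_def by simp
        qed
        moreover have "fst ` C \<subseteq> V1" using C(1) by auto
        ultimately have c1: "real (card (fst ` C)) \<le> real (t + 1) * p"
          using g(2)[THEN spec, THEN mp, THEN spec, THEN mp, THEN mp] linked_strong_product(1)[OF C(3)]
          by metis
        \<comment> \<open>The first block of a level may start at a negative number; truncating the
          start to 0 still leaves all its layers in the window.\<close>
        have "\<forall>v \<in> snd ` C. nat (s z0) \<le> l v \<and> l v < nat (s z0) + m"
        proof
          fix v assume v: "v \<in> snd ` C"
          obtain z where "z \<in> C" "v = snd z" using v by blast
          then have "s z0 \<le> int (l v)" "int (l v) < s z0 + int m"
            using s_eq[of z] block_start_bounds[OF m(1), where i = "g (fst z)" and l = "l v"]
            unfolding s_def by simp_all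
          then show "nat (s z0) \<le> l v \<and> l v < nat (s z0) + m" by linarith
        qed
        moreover have "snd ` C \<subseteq> V2" using C(1) by auto
        ultimately have "card (snd ` C) \<le> (4 * \<Delta>) ^ m * (12 * (t + 1) * \<Delta>)"
          using l(2) linked_strong_product(2)[OF C(3)] by metis
        then have "real (card (snd ` C)) \<le> real ((4 * \<Delta>) ^ m * (12 * (t + 1) * \<Delta>))"
          by (simp only: of_nat_le_iff)
        with c1 have "real (card (fst ` C)) * real (card (snd ` C)) \<le>
            real (t + 1) * p * real ((4 * \<Delta>) ^ m * (12 * (t + 1) * \<Delta>))"
          by (intro mult_mono) (use p in auto)
        moreover have "real (card C) \<le> real (card (fst ` C)) * real (card (snd ` C))"
          using card_product_le[OF fC] by (metis of_nat_le_iff of_nat_mult)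
        ultimately have "real (card C) \<le> real (t + 1) * p * real ((4 * \<Delta>) ^ m * (12 * (t + 1) * \<Delta>))"
          by linarith
        \<comment> \<open>One factor \<open>t + 1\<close> comes from the levels and one from the
          layers; \<open>\<Delta> ^ m * \<Delta>\<close> is \<open>\<Delta> ^ c\<close>.\<close>
        also have "\<dots> = (12 * 4 ^ m) * ((real t + 1) ^ 2 * real \<Delta> ^ c * p)"
          by (simp add: m(2) power_mult_distrib power2_eq_square algebra_simps)
        also have "\<dots> \<le> 6 ^ (c + 1) * ((real t + 1) ^ 2 * real \<Delta> ^ c * M)"
        proof (intro mult_mono mult_left_mono)
          \<comment> \<open>As \<open>c + 1 = m + 2\<close>, the constant \<open>6 ^ (c + 1)\<close>
            is \<open>36 * 6 ^ m\<close>.\<close>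
          have "(4 :: real) ^ m \<le> 6 ^ m" by (rule power_mono) auto
          moreover have "0 \<le> (6 :: real) ^ m" by simp
          ultimately have "(4 :: real) ^ m \<le> 3 * 6 ^ m" by linarith
          then show "12 * 4 ^ m \<le> (6 :: real) ^ (c + 1)" by (simp add: m(2))
          show "p \<le> M"
            using thick_product_bound[OF pos c2 D_def] \<open>\<not> n2 \<le> (n1 * n2) powr (1 / D)\<close>
            by (simp add: p_def M_def m(3))
        qed (use p in auto)
        finally show ?thesis by (simp add: K_def mult.assoc)
      qed
      moreover have "f z < c" for z
        unfolding f_def using m(2) pos_mod_bound[of "int m + 1" "s z"] by (simp add: nat_less_iff)
      ultimately show ?thesis by blast
    qed
  qed
  then obtain f :: "'a \<times> 'b \<Rightarrow> nat" where f: "\<forall>z. f z < c"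
    "\<forall>C \<subseteq> V1 \<times> V2. \<forall>i. (\<forall>v \<in> C. f v = i) \<longrightarrow> linked (parcs (H1 \<boxtimes> H2)) C \<longrightarrow> real (card C) \<le> K * M"
    by blast
  have "card (f ` pverts (H1 \<boxtimes> H2)) \<le> card {..<c}" using f(1) by (intro card_mono) auto
  then have "uses_at_most_colours (H1 \<boxtimes> H2) f c" by (simp add: uses_at_most_colours_def)
  moreover have "clustering_at_most (H1 \<boxtimes> H2) f (K * M)"
    by (rule clustering_at_mostI) (use f(2) V in auto)
  ultimately show ?thesis unfolding M_eq K_def[symmetric] by blast
qed

end
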